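(* Let $(M,\mathbf c)$ be a compact Riemannian conformal $n$-manifold with nonempty boundary $\Sigma=\partial M$. Let $k\in\mathbb Z_{>0}$, and suppose that $n$ is odd, or $n$ is even and $k\le n/2$, or $(M,\mathbf c)$ is conformally flat. Let $B=(\delta^T_0,\delta^T_1,\dots,\delta^T_{k-1})$. Then the boundary problem $(P_{2k},B)$ satisfies the Lopatinski–Shapiro condition.
   Context: Setting. Everything is smooth. $(M,\mathbf c)$ is an $n$-dimensional manifold ($n\ge3$) with a conformal class $\mathbf c$ of Riemannian metrics, and $\Sigma\subset M$ is an embedded hypersurface; $M,\Sigma$ are orientable and $\Sigma$ is oriented. If $\Sigma=\partial M$, $M$ is extended by a collar so that $\Sigma$ consists of interior points. $\mathcal E[w]$ ($w\in\mathbb R$) is the line bundle of conformal densities of weight $w$ (associated to the $\mathbb R_{>0}$-bundle of metrics in $\mathbf c$ via $x\mapsto x^{-w/2}$), or its space of sections; $\mathcal E[0]=C^\infty(M)$, $\bar{\mathcal E}[w]=\mathcal E[w]|_\Sigma$. The conformal metric $\boldsymbol g_{ab}$ is the tautological section of $S^2T^*M\otimes\mathcal E[2]$; it and its inverse raise and lower indices. For $g\in\mathbf c$, $\nabla$ is the Levi-Civita connection, $R_{ab}{}^c{}_d$ its curvature, $(\nabla_a\nabla_b-\nabla_b\nabla_a)V^c=R_{ab}{}^c{}_dV^d$, $R_{ca}{}^c{}_b=(n-2)\mathsf P_{ab}+\mathsf J\boldsymbol g_{ab}$, $\mathsf J=\mathsf P_a{}^a$, $\Delta=\nabla^a\nabla_a$.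 Conformally flat means that the Weyl and Cotton tensors vanish. For a local defining function $t$ of $\Sigma$ (zero set $\Sigma$, $dt$ nowhere zero, compatible with the orientation), $n_a=dt/|dt|_{\boldsymbol g}$ and $H=\frac1{n-1}\nabla_an^a$ (mean curvature, weight $-1$). An operator $B$ from sections over $M$ to sections along $\Sigma$ has transverse order $m>0$ if at each $p\in\Sigma$, $B(t^mV)|_p\ne0$ for some $V$ while $B(t^{m+1}V')|_p=0$ for all $V'$ (transverse order $0$: $B(tV)=0$ along $\Sigma$ for all $V$). Lopatinski–Shapiro condition. Let $A$ be a differential operator of even order $2k$ on $\mathcal E[w]$ with leading symbol $a(x,\xi)$. It is elliptic if $|a(x,\xi)|\ge C|\xi|^{2k}$ for some $C>0$, and properly elliptic if, for all $x\in\Sigma$ and all $\eta_a$ not parallel to $n_a$ at $x$, the zeros of $\tau\mapsto a(x,\eta_a+\tau n_a)$ can be labelled $\tau_i^\pm$, $1\le i\le k$, with $\operatorname{Im}\tau_i^+>0>\operatorname{Im}\tau_i^-$. ($P_{2k}$ is elliptic and properly elliptic.) Let $O=(O_1,\dots,O_k)$ be boundary operators of orders $0\le m_1<\dots<m_k<2k$ with leading symbols $b_i(x,\xi)$. The pair $(A,O)$ satisfies the Lopatinski–Shapiro condition if for all $x\in\Sigma$ and all $\eta_a$ not parallel to $n_a$ at $x$, the classes of the polynomials $b_i(x,\eta_a+\tau n_a)$, $1\le i\le k$, are linearly independent in $\mathbb C[\tau]/I$, where $I$ is the ideal generated by $\prod_{i=1}^k(\tau-\tau_i^+)$. Tractors.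 $\mathcal T^A$ is the standard tractor bundle (rank $n+2$); $g\in\mathbf c$ splits it as $\mathcal E[1]\oplus\mathcal E_b[1]\oplus\mathcal E[-1]$, $V^A=\sigma Y^A+\mu_bZ^{Ab}+\rho X^A$, with $(\sigma,\mu_b,\rho)\mapsto(\sigma,\mu_b+\sigma\Upsilon_b,\rho-\Upsilon^c\mu_c-\frac12\sigma\Upsilon^c\Upsilon_c)$ under $\hat g=e^{2\Upsilon}g$, $\Upsilon_a=\nabla_a\Upsilon$. The tractor metric $h$ has $Y_AX^A=1$, $Z_A{}^bZ^{Ac}=\boldsymbol g^{bc}$ and other pairings zero; the tractor connection satisfies $\nabla_aY^A=\mathsf P_{ab}Z^{Ab}$, $\nabla_aZ^A{}_b=-\mathsf P_{ab}X^A-\boldsymbol g_{ab}Y^A$, $\nabla_aX^A=Z^A{}_a$, with curvature $(\nabla_i\nabla_j-\nabla_j\nabla_i)V^A=\Omega_{ij}{}^A{}_BV^B$; $W_{ABCE}=(n-4)Z_A{}^aZ_B{}^b\Omega_{abCE}-2X_{[A}Z_{B]}{}^b\nabla^p\Omega_{pbCE}$. $\mathcal T^\Phi[w]$ is any tensor power of $\mathcal T$ tensored with $\mathcal E[w]$. On $V\in\mathcal T^\Phi[w]$: $\Box V=(\Delta+w\mathsf J)V$ and $D_AV=w(n+2w-2)Y_AV+(n+2w-2)Z_A{}^b\nabla_bV-X_A\Box V$. The normal tractor is $N^A=n_bZ^{Ab}-HX^A$, and $\delta V=n^a\nabla_aV-wHV$ along $\Sigma$. Operators. $\delta_1=\delta$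 and $\delta_K=N^{A_1}\cdots N^{A_{K-1}}\delta D_{A_1}\cdots D_{A_{K-1}}:\mathcal T^\Phi[w]\to\mathcal T^\Phi[w-K]|_\Sigma$. In the conformally flat case $\delta^0_K:\mathcal E[w]\to\bar{\mathcal E}[w-K]$ is given by $\big[\prod_{j=1}^{\lfloor (K-1)/2\rfloor}(n+2w-2K+2j)\big]\delta^0_K=\delta_K$ and polynomial continuation in $w$. For $k'\ge1$ with $n$ odd, or $n$ even and $k'\le n/2$, or $\mathbf c$ conformally flat, $P_{2k'}:\mathcal E[k'-n/2]\to\mathcal E[-k'-n/2]$ is the GJMS operator, with leading term $\Delta^{k'}$. Fix (from the Gover–Peterson tractor formula for $P_{2k'}$) operators $\mathcal P^{k'}_{A_1\cdots A_{k'-1}}$ with $(-1)^{k'-1}X_{A_1}\cdots X_{A_{k'-1}}P_{2k'}V=\Box D_{A_1}\cdots D_{A_{k'-1}}V+\mathcal P^{k'}_{A_1\cdots A_{k'-1}}V$ for $V\in\mathcal E[k'-n/2]$; they are zero if $k'\in\{1,2\}$ or $\mathbf c$ is conformally flat, and otherwise have the form $\Psi^{k'}_{A_1\cdots A_{k'-1}}{}^{PQ}D_PD_Q$, given by polynomials in $X,D,W,h,h^{-1}$ with coefficients rational in $n$, every term having degree $\ge1$ in $W$, mass $k'+1$ and weight $-k'-1$, and carrying at least one of the indices $A_i$ on a $W$ (mass: curvatures $R,\Omega,W$ count $2$, $\nabla,Y,D$ count $1$, $X$ counts $-1$, $n_a,\boldsymbol g,Z,h$ count $0$). The same formula is used on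 $\mathcal E[w]$ for all $w$. Put $P_{A_1\cdots A_{k'}}V=D_{A_1}\cdots D_{A_{k'}}V-X_{A_1}\mathcal P^{k'}_{A_2\cdots A_{k'}}V$. Then $\delta_{J,k'}:\mathcal E[w]\to\bar{\mathcal E}[w-J-k']$ is $N^{A_1}\cdots N^{A_{k'}}\delta_JP_{A_1\cdots A_{k'}}$ if $k'\le J$, and is determined by $(n+2w-2k')\delta_{J,k'}=N^{A_1}\cdots N^{A_{k'}}\delta_JP_{A_1\cdots A_{k'}}$ and polynomial continuation in $w$ if $k'>J$. The operators $\delta^T_i$. $\delta^T_0$ is restriction to $\Sigma$. For $i\ge1$, $\delta^T_i:\mathcal E[k-n/2]\to\bar{\mathcal E}[k-n/2-i]$ denotes any one of the available operators among $\delta_i$, $\delta^0_i$ (conformally flat case) and $\delta_{J,k'}$ ($J+k'=i$) which on $\mathcal E[k-n/2]$ has order and transverse order $i$; such an operator exists for $1\le i\le 2k-1$. *)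

theory Defs
  imports "HOL-Analysis.Analysis" "HOL-Computational_Algebra.Polynomial"
begin

section \<open>Smooth functions on open subsets of coordinate space\<close>

definition pd :: "'n::finite \<Rightarrow> (real^'n \<Rightarrow> real) \<Rightarrow> real^'n \<Rightarrow> real" where
  "pd i f x = frechet_derivative f (at x) (axis i 1)"

abbreviation pds :: "'n::finite list \<Rightarrow> (real^'n \<Rightarrow> real) \<Rightarrow> real^'n \<Rightarrow> real" where
  "pds is f \<equiv> foldr pd is f"

definition smooth_on :: "(real^'n::finite) set \<Rightarrow> (real^'n \<Rightarrow> real) \<Rightarrow> bool" where
  "smooth_on S f \<longleftrightarrow> (\<forall>is. \<forall>x\<in>S. pds is f differentiable (at x))"


section \<open>Pseudo-Riemannian geometry in coordinates\<close>

text \<open>A metric is given by its component matrix, as a function of the coordinates. The index type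
  is arbitrary, so that the same formulas serve a metric on an \<open>n\<close>-manifold and its
  \<open>(n+2)\<close>-dimensional ambient metric.\<close>

type_synonym 'n gmat = "real^'n \<Rightarrow> real^'n^'n"

definition ginv :: "'n::finite gmat \<Rightarrow> real^'n \<Rightarrow> real^'n^'n" where
  "ginv G x = matrix_inv (G x)"

text \<open>\<open>chris G c a b\<close> is \<open>\<Gamma>\<^sup>c\<^sub>a\<^sub>b\<close>.\<close>
definition chris :: "'n::finite gmat \<Rightarrow> 'n \<Rightarrow> 'n \<Rightarrow> 'n \<Rightarrow> real^'n \<Rightarrow> real" where
  "chris G c a b x = (1/2) * (\<Sum>d\<in>UNIV. ginv G x $ c $ d *
     (pd a (\<lambda>y. G y $ d $ b) x + pd b (\<lambda>y. G y $ d $ a) x - pd d (\<lambda>y. G y $ a $ b) x))"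

text \<open>\<open>riem G a b c d\<close> is \<open>R\<^sub>a\<^sub>b\<^sup>c\<^sub>d\<close>, where
  \<open>(\<nabla>\<^sub>a\<nabla>\<^sub>b - \<nabla>\<^sub>b\<nabla>\<^sub>a)V\<^sup>c = R\<^sub>a\<^sub>b\<^sup>c\<^sub>d V\<^sup>d\<close>.\<close>
definition riem :: "'n::finite gmat \<Rightarrow> 'n \<Rightarrow> 'n \<Rightarrow> 'n \<Rightarrow> 'n \<Rightarrow> real^'n \<Rightarrow> real" where
  "riem G a b c d x = pd a (chris G c b d) x - pd b (chris G c a d) x
     + (\<Sum>e\<in>UNIV. chris G c a e x * chris G e b d x - chris G c b e x * chris G e a d x)"

definition ric :: "'n::finite gmat \<Rightarrow> 'n \<Rightarrow> 'n \<Rightarrow> real^'n \<Rightarrow> real" where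
  "ric G a b x = (\<Sum>c\<in>UNIV. riem G c a c b x)"

definition laplacian :: "'n::finite gmat \<Rightarrow> (real^'n \<Rightarrow> real) \<Rightarrow> real^'n \<Rightarrow> real" where
  "laplacian G f x = (\<Sum>a\<in>UNIV. \<Sum>b\<in>UNIV. ginv G x $ a $ b *
     (pd a (pd b f) x - (\<Sum>c\<in>UNIV. chris G c a b x * pd c f x)))"

text \<open>The solution of \<open>R\<^sub>a\<^sub>b = (n-2)P\<^sub>a\<^sub>b + J g\<^sub>a\<^sub>b\<close> with \<open>J = P\<^sub>a\<^sup>a\<close>.\<close>
definition schouten_tr :: "'n::finite gmat \<Rightarrow> real^'n \<Rightarrow> real" where
  "schouten_tr G x = (\<Sum>a\<in>UNIV. \<Sum>b\<in>UNIV. ginv G x $ a $ b * ric G a b x)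
     / (2 * (real CARD('n) - 1))"

definition schouten :: "'n::finite gmat \<Rightarrow> 'n \<Rightarrow> 'n \<Rightarrow> real^'n \<Rightarrow> real" where
  "schouten G a b x = (ric G a b x - schouten_tr G x * G x $ a $ b) / (real CARD('n) - 2)"

text \<open>\<open>weyl G a b c d\<close> has all indices lowered and the index order of \<open>R\<^sub>a\<^sub>b\<^sub>c\<^sub>d\<close>.\<close>
definition weyl :: "'n::finite gmat \<Rightarrow> 'n \<Rightarrow> 'n \<Rightarrow> 'n \<Rightarrow> 'n \<Rightarrow> real^'n \<Rightarrow> real" where
  "weyl G a b c d x = (\<Sum>e\<in>UNIV. G x $ c $ e * riem G a b e d x)
     - (G x $ c $ a * schouten G b d x - G x $ c $ b * schouten G a d x
        + G x $ d $ b * schouten G a c x - G x $ d $ a * schouten G b c x)"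

text \<open>\<open>\<nabla>\<^sub>aP\<^sub>b\<^sub>c - \<nabla>\<^sub>bP\<^sub>a\<^sub>c\<close>; the terms with \<open>\<Gamma>\<^sup>d\<^sub>a\<^sub>b P\<^sub>d\<^sub>c\<close> cancel.\<close>
definition cotton :: "'n::finite gmat \<Rightarrow> 'n \<Rightarrow> 'n \<Rightarrow> 'n \<Rightarrow> real^'n \<Rightarrow> real" where
  "cotton G a b c x = pd a (schouten G b c) x - pd b (schouten G a c) x
     - (\<Sum>d\<in>UNIV. chris G d a c x * schouten G b d x - chris G d b c x * schouten G a d x)"


section \<open>Conformal manifolds with boundary\<close>

text \<open>The points of type \<open>'m\<close> form a manifold without boundary which contains the manifold \<open>M\<close> of
  interest as a compact domain with smooth boundary (\<open>M\<close> with a collar added). Charts are pairs of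
  a domain and a coordinate map, and a metric is given by its components in each chart.\<close>

type_synonym ('m,'n) chart = "'m set \<times> ('m \<Rightarrow> real^'n)"
type_synonym ('m,'n) metric = "('m,'n) chart \<Rightarrow> 'm \<Rightarrow> real^'n^'n"

text \<open>\<open>coor\<close> encodes the orientation of \<open>\<Sigma> = frontier M\<close> through its co-orientation: it is \<open>1\<close> where
  the distinguished conormal points into \<open>M\<close> and \<open>-1\<close> where it points out of \<open>M\<close>.\<close>
record ('m,'n) cmfd =
  atlas :: "('m,'n) chart set"
  body :: "'m set"
  cclass :: "('m,'n) metric set"
  coor :: "'m \<Rightarrow> real"

abbreviation bdry :: "('m::topological_space,'n) cmfd \<Rightarrow> 'm set" where
  "bdry X \<equiv> frontier (body X)"

definition loc :: "('m,'n) chart \<Rightarrow> ('m \<Rightarrow> 'a) \<Rightarrow> real^'n \<Rightarrow> 'a" where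
  "loc ch u x = u (inv_into (fst ch) (snd ch) x)"

definition smooth_atlas ::
    "('m::topological_space,'n::finite) chart set \<Rightarrow> bool" where
  "smooth_atlas A \<longleftrightarrow> (\<Union>ch\<in>A. fst ch) = UNIV
   \<and> (\<forall>ch\<in>A. open (fst ch) \<and> open (snd ch ` fst ch)
        \<and> homeomorphism (fst ch) (snd ch ` fst ch) (snd ch) (inv_into (fst ch) (snd ch)))
   \<and> (\<forall>ch\<in>A. \<forall>ch'\<in>A. \<forall>i.
        smooth_on (snd ch ` (fst ch \<inter> fst ch')) (loc ch (\<lambda>q. snd ch' q $ i)))"

definition msmooth_on ::
    "('m,'n::finite) chart set \<Rightarrow> 'm set \<Rightarrow> ('m \<Rightarrow> real) \<Rightarrow> bool" where
  "msmooth_on A U f \<longleftrightarrow> (\<forall>ch\<in>A. smooth_on (snd ch ` (fst ch \<inter> U)) (loc ch f))"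

text \<open>Jacobian matrix at \<open>p\<close> of the change of coordinates from \<open>ch\<close> to \<open>ch'\<close>.\<close>
definition jac ::
    "('m,'n::finite) chart \<Rightarrow> ('m,'n) chart \<Rightarrow> 'm \<Rightarrow> real^'n^'n" where
  "jac ch ch' p = (\<chi> i j. pd j (loc ch (\<lambda>q. snd ch' q $ i)) (snd ch p))"

text \<open>An orientation of \<open>S\<close> is recorded by the sign of each chart of the given atlas relative to it.\<close>
definition orientable ::
    "('m::topological_space,'n::finite) chart set \<Rightarrow> 'm set \<Rightarrow> bool" where
  "orientable A S \<longleftrightarrow> (\<exists>s :: ('m,'n) chart \<Rightarrow> 'm \<Rightarrow> real.
     (\<forall>ch\<in>A. continuous_on (fst ch \<inter> S) (s ch) \<and> (\<forall>p\<in>fst ch \<inter> S. s ch p \<in> {-1, 1}))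
   \<and> (\<forall>ch\<in>A. \<forall>ch'\<in>A. \<forall>p\<in>fst ch \<inter> fst ch' \<inter> S. s ch p * s ch' p * det (jac ch ch' p) > 0))"

definition riemannian_metric ::
    "('m,'n::finite) chart set \<Rightarrow> ('m,'n) metric \<Rightarrow> bool" where
  "riemannian_metric A g \<longleftrightarrow>
     (\<forall>ch\<in>A. \<forall>i j. smooth_on (snd ch ` fst ch) (\<lambda>x. loc ch (g ch) x $ i $ j))
   \<and> (\<forall>ch\<in>A. \<forall>p\<in>fst ch. transpose (g ch p) = g ch p \<and> (\<forall>v. v \<noteq> 0 \<longrightarrow> v \<bullet> (g ch p *v v) > 0))
   \<and> (\<forall>ch\<in>A. \<forall>ch'\<in>A. \<forall>p\<in>fst ch \<inter> fst ch'.
        g ch p = transpose (jac ch ch' p) ** g ch' p ** jac ch ch' p)"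

definition rescale :: "('m \<Rightarrow> real) \<Rightarrow> ('m,'n::finite) metric \<Rightarrow> ('m,'n) metric" where
  "rescale \<Upsilon> g = (\<lambda>ch p. exp (2 * \<Upsilon> p) *\<^sub>R g ch p)"

definition conformal_class ::
    "('m,'n::finite) chart set \<Rightarrow> ('m,'n) metric set \<Rightarrow> bool" where
  "conformal_class A c \<longleftrightarrow> (\<exists>g. riemannian_metric A g \<and>
     c = {rescale \<Upsilon> g |\<Upsilon>. msmooth_on A UNIV \<Upsilon>})"

definition defining_function ::
    "('m::topological_space,'n::finite) cmfd \<Rightarrow> 'm \<Rightarrow> 'm set \<Rightarrow> ('m \<Rightarrow> real) \<Rightarrow> bool" where
  "defining_function X p U t \<longleftrightarrow> open U \<and> p \<in> U \<and> msmooth_on (atlas X) U t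
   \<and> (\<forall>q\<in>U. t q = 0 \<longleftrightarrow> q \<in> bdry X)
   \<and> (\<forall>q\<in>U. q \<in> body X \<longleftrightarrow> 0 \<le> coor X p * t q)
   \<and> (\<forall>ch\<in>atlas X. \<forall>q\<in>U \<inter> fst ch. \<exists>i. pd i (loc ch t) (snd ch q) \<noteq> 0)"

definition compact_conformal_manifold_with_boundary ::
    "('m::topological_space,'n::finite) cmfd \<Rightarrow> bool" where
  "compact_conformal_manifold_with_boundary X \<longleftrightarrow>
     smooth_atlas (atlas X) \<and> conformal_class (atlas X) (cclass X)
   \<and> compact (body X) \<and> bdry X \<noteq> {}
   \<and> continuous_on (bdry X) (coor X) \<and> (\<forall>p\<in>bdry X. coor X p \<in> {-1, 1})
   \<and> (\<forall>p\<in>bdry X. \<exists>U t. defining_function X p U t)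
   \<and> orientable (atlas X) (body X)"

definition conformally_flat :: "('m,'n::finite) cmfd \<Rightarrow> bool" where
  "conformally_flat X \<longleftrightarrow> (\<forall>g\<in>cclass X. \<forall>ch\<in>atlas X. \<forall>p\<in>fst ch \<inter> body X. \<forall>a b c d.
     weyl (loc ch (g ch)) a b c d (snd ch p) = 0 \<and> cotton (loc ch (g ch)) a b c (snd ch p) = 0)"


section \<open>Densities, differential operators and their symbols\<close>

text \<open>A density is determined by the functions that trivialise it in the scales of the class.\<close>

type_synonym ('m,'n) dens = "('m,'n) metric \<Rightarrow> 'm \<Rightarrow> real"
type_synonym ('m,'n) dop = "('m,'n) dens \<Rightarrow> ('m,'n) dens"

definition densities :: "('m,'n::finite) cmfd \<Rightarrow> real \<Rightarrow> ('m,'n) dens set" where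
  "densities X w = {V. (\<forall>g\<in>cclass X. msmooth_on (atlas X) UNIV (V g))
     \<and> (\<forall>g\<in>cclass X. \<forall>\<Upsilon>. msmooth_on (atlas X) UNIV \<Upsilon> \<longrightarrow>
          (\<forall>p. V (rescale \<Upsilon> g) p = exp (w * \<Upsilon> p) * V g p))}"

text \<open>\<open>A\<close> maps densities of weight \<open>w\<close> to densities along \<open>S\<close> of weight \<open>w'\<close>.\<close>
definition maps_weight ::
    "('m,'n::finite) cmfd \<Rightarrow> 'm set \<Rightarrow> real \<Rightarrow> real \<Rightarrow> ('m,'n) dop \<Rightarrow> bool" where
  "maps_weight X S w w' A \<longleftrightarrow> (\<forall>V\<in>densities X w. \<forall>g\<in>cclass X. \<forall>\<Upsilon>.
     msmooth_on (atlas X) UNIV \<Upsilon> \<longrightarrow>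
     (\<forall>p\<in>S. A V (rescale \<Upsilon> g) p = exp (w' * \<Upsilon> p) * A V g p))"

text \<open>\<open>a\<close> gives coefficients, over \<open>S\<close> and in the chart \<open>ch\<close> and scale \<open>g\<close>, of \<open>A\<close> as a differential
  operator of order at most \<open>m\<close>. A derivative of order \<open>j\<close> is indexed by a list of \<open>j\<close> coordinate
  indices; the coefficients need not be symmetric, but the symbol formed from them is unique.
  With \<open>S\<close> the boundary, these are the operators from sections over \<open>M\<close> to sections along it.\<close>
definition is_coeffs :: "('m,'n::finite) cmfd \<Rightarrow> 'm set \<Rightarrow> real \<Rightarrow> nat \<Rightarrow> ('m,'n) dop \<Rightarrow>
    ('m,'n) metric \<Rightarrow> ('m,'n) chart \<Rightarrow> ('n list \<Rightarrow> real^'n \<Rightarrow> real) \<Rightarrow> bool" where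
  "is_coeffs X S w m A g ch a \<longleftrightarrow> (\<forall>is. smooth_on (snd ch ` fst ch) (a is))
   \<and> (\<forall>V\<in>densities X w. \<forall>p\<in>fst ch \<inter> S.
        A V g p = (\<Sum>is | length is \<le> m. a is (snd ch p) * pds is (loc ch (V g)) (snd ch p)))"

definition diff_op ::
    "('m,'n::finite) cmfd \<Rightarrow> 'm set \<Rightarrow> real \<Rightarrow> nat \<Rightarrow> ('m,'n) dop \<Rightarrow> bool" where
  "diff_op X S w m A \<longleftrightarrow> (\<forall>g\<in>cclass X. \<forall>ch\<in>atlas X. \<exists>a. is_coeffs X S w m A g ch a)"

definition has_order ::
    "('m,'n::finite) cmfd \<Rightarrow> 'm set \<Rightarrow> real \<Rightarrow> nat \<Rightarrow> ('m,'n) dop \<Rightarrow> bool" where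
  "has_order X S w m A \<longleftrightarrow> diff_op X S w m A \<and> (\<forall>m'<m. \<not> diff_op X S w m' A)"

definition symb :: "('n::finite list \<Rightarrow> real^'n \<Rightarrow> real) \<Rightarrow> nat \<Rightarrow> real^'n \<Rightarrow> real^'n \<Rightarrow> real" where
  "symb a m x \<xi> = (\<Sum>is | length is = m. a is x * (\<Prod>i\<leftarrow>is. \<xi> $ i))"

text \<open>The leading symbol at \<open>\<eta> + \<tau> \<nu>\<close>, as a polynomial in \<open>\<tau>\<close>.\<close>
definition symb_line ::
    "('n::finite list \<Rightarrow> real^'n \<Rightarrow> real) \<Rightarrow> nat \<Rightarrow> real^'n \<Rightarrow> real^'n \<Rightarrow> real^'n \<Rightarrow> complex poly" where
  "symb_line a m x \<eta> \<nu> = (\<Sum>is | length is = m.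
     smult (of_real (a is x)) (\<Prod>i\<leftarrow>is. [:of_real (\<eta> $ i), of_real (\<nu> $ i):]))"

text \<open>Multiplication by a power of a local defining function \<open>t\<close> is only defined near \<open>p\<close>; as \<open>B\<close> is
  local, it suffices to apply \<open>B\<close> to sections \<open>W\<close> which agree with \<open>t\<^sup>m V\<close> near \<open>p\<close>.\<close>
definition power_times_near :: "('m::topological_space,'n::finite) cmfd \<Rightarrow> 'm \<Rightarrow> ('m \<Rightarrow> real) \<Rightarrow>
    nat \<Rightarrow> ('m,'n) dens \<Rightarrow> ('m,'n) dens \<Rightarrow> bool" where
  "power_times_near X p t m V W \<longleftrightarrow>
     (\<exists>U. open U \<and> p \<in> U \<and> (\<forall>g\<in>cclass X. \<forall>q\<in>U. W g q = t q ^ m * V g q))"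

definition has_transverse_order ::
    "('m::topological_space,'n::finite) cmfd \<Rightarrow> real \<Rightarrow> nat \<Rightarrow> ('m,'n) dop \<Rightarrow> bool" where
  "has_transverse_order X w m B \<longleftrightarrow>
     (\<forall>p\<in>bdry X. \<forall>U t. defining_function X p U t \<longrightarrow> (\<forall>g\<in>cclass X.
        (m > 0 \<longrightarrow> (\<exists>V\<in>densities X w. \<exists>W\<in>densities X w.
            power_times_near X p t m V W \<and> B W g p \<noteq> 0))
      \<and> (\<forall>V\<in>densities X w. \<forall>W\<in>densities X w.
            power_times_near X p t (m + 1) V W \<longrightarrow> B W g p = 0)))"


section \<open>Hypersurface geometry in coordinates\<close>

definition conormal :: "'n::finite gmat \<Rightarrow> (real^'n \<Rightarrow> real) \<Rightarrow> 'n \<Rightarrow> real^'n \<Rightarrow> real" where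
  "conormal G t a x =
     pd a t x / sqrt (\<Sum>b\<in>UNIV. \<Sum>c\<in>UNIV. ginv G x $ b $ c * pd b t x * pd c t x)"

definition mean_curv :: "'n::finite gmat \<Rightarrow> (real^'n \<Rightarrow> real) \<Rightarrow> real^'n \<Rightarrow> real" where
  "mean_curv G t x = (\<Sum>a\<in>UNIV. \<Sum>b\<in>UNIV. ginv G x $ a $ b *
      (pd a (conormal G t b) x - (\<Sum>c\<in>UNIV. chris G c a b x * conormal G t c x)))
     / (real CARD('n) - 1)"


section \<open>The Lopatinski--Shapiro condition\<close>

definition elliptic ::
    "('m,'n::finite) cmfd \<Rightarrow> real \<Rightarrow> nat \<Rightarrow> ('m,'n) dop \<Rightarrow> bool" where
  "elliptic X w k A \<longleftrightarrow> (\<forall>g\<in>cclass X. \<exists>C>0. \<forall>ch\<in>atlas X. \<forall>a.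
     is_coeffs X (body X) w (2*k) A g ch a \<longrightarrow> (\<forall>p\<in>fst ch \<inter> body X. \<forall>\<xi>.
       \<bar>symb a (2*k) (snd ch p) \<xi>\<bar> \<ge> C * sqrt (\<xi> \<bullet> (matrix_inv (g ch p) *v \<xi>)) ^ (2*k)))"

definition labelled_zeros ::
    "complex poly \<Rightarrow> nat \<Rightarrow> (nat \<Rightarrow> complex) \<Rightarrow> (nat \<Rightarrow> complex) \<Rightarrow> bool" where
  "labelled_zeros q k \<tau>p \<tau>m \<longleftrightarrow> (\<forall>i<k. Im (\<tau>p i) > 0 \<and> 0 > Im (\<tau>m i))
   \<and> (\<exists>c. c \<noteq> 0 \<and> q = smult c (\<Prod>i<k. [:- \<tau>p i, 1:] * [:- \<tau>m i, 1:]))"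

definition conormal_vec ::
    "('m,'n::finite) metric \<Rightarrow> ('m,'n) chart \<Rightarrow> ('m \<Rightarrow> real) \<Rightarrow> 'm \<Rightarrow> real^'n" where
  "conormal_vec g ch t p = (\<chi> a. conormal (loc ch (g ch)) (loc ch t) a (snd ch p))"

definition properly_elliptic ::
    "('m::topological_space,'n::finite) cmfd \<Rightarrow> real \<Rightarrow> nat \<Rightarrow> ('m,'n) dop \<Rightarrow> bool" where
  "properly_elliptic X w k A \<longleftrightarrow>
     (\<forall>g\<in>cclass X. \<forall>ch\<in>atlas X. \<forall>a. is_coeffs X (body X) w (2*k) A g ch a \<longrightarrow>
       (\<forall>p\<in>fst ch \<inter> bdry X. \<forall>U t. defining_function X p U t \<longrightarrow>
         (\<forall>\<eta>. (\<nexists>s. \<eta> = s *\<^sub>R conormal_vec g ch t p) \<longrightarrow>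
           (\<exists>\<tau>p \<tau>m. labelled_zeros
              (symb_line a (2*k) (snd ch p) \<eta> (conormal_vec g ch t p)) k \<tau>p \<tau>m))))"

text \<open>Linear independence of the classes of polynomials
  \<open>b\<^sub>i\<close> modulo the ideal generated by \<open>q\<close> means that \<open>q\<close> divides no nontrivial linear combination.\<close>
definition independent_mod :: "complex poly \<Rightarrow> nat \<Rightarrow> (nat \<Rightarrow> complex poly) \<Rightarrow> bool" where
  "independent_mod q k b \<longleftrightarrow>
     (\<forall>c. q dvd (\<Sum>i<k. smult (c i) (b i)) \<longrightarrow> (\<forall>i<k. c i = 0))"

text \<open>Ellipticity and proper ellipticity, without which the zeros \<open>\<tau>\<^sub>i\<^sup>\<plusminus>\<close> are not defined, are part of
  the condition. The boundary operators are \<open>B i\<close>, \<open>i < k\<close>. As symbols of densities are themselves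
  densities, the condition is the same in every scale.\<close>
definition lopatinski_shapiro :: "('m::topological_space,'n::finite) cmfd \<Rightarrow> real \<Rightarrow> nat \<Rightarrow>
    ('m,'n) dop \<Rightarrow> (nat \<Rightarrow> ('m,'n) dop) \<Rightarrow> bool" where
  "lopatinski_shapiro X w k A B \<longleftrightarrow>
     diff_op X (body X) w (2*k) A \<and> elliptic X w k A \<and> properly_elliptic X w k A
   \<and> (\<exists>m. (\<forall>i<k. has_order X (bdry X) w (m i) (B i) \<and> m i < 2*k)
        \<and> (\<forall>i j. i < j \<longrightarrow> j < k \<longrightarrow> m i < m j)
        \<and> (\<forall>g\<in>cclass X. \<forall>ch\<in>atlas X. \<forall>a b.
             is_coeffs X (body X) w (2*k) A g ch a \<longrightarrow>
             (\<forall>i<k. is_coeffs X (bdry X) w (m i) (B i) g ch (b i)) \<longrightarrow>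
             (\<forall>p\<in>fst ch \<inter> bdry X. \<forall>U t. defining_function X p U t \<longrightarrow>
               (\<forall>\<eta>. (\<nexists>s. \<eta> = s *\<^sub>R conormal_vec g ch t p) \<longrightarrow>
                 (\<forall>\<tau>p \<tau>m. labelled_zeros
                     (symb_line a (2*k) (snd ch p) \<eta> (conormal_vec g ch t p)) k \<tau>p \<tau>m \<longrightarrow>
                   independent_mod (\<Prod>i<k. [:- \<tau>p i, 1:]) k
                     (\<lambda>i. symb_line (b i) (m i) (snd ch p) \<eta> (conormal_vec g ch t p)))))))"


section \<open>GJMS operators\<close>

text \<open>The index type for ambient coordinates and for tractor frames. As ambient coordinates,
  \<open>Top\<close>, \<open>Mid i\<close>, \<open>Bot\<close> stand for \<open>t\<close>, \<open>x\<^sup>i\<close>, \<open>\<rho>\<close>; as tractor frame elements for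
  \<open>Y\<^sup>A\<close>, \<open>Z\<^sup>A\<^sup>i\<close>, \<open>X\<^sup>A\<close>.\<close>
datatype 'n ext = Top | Mid 'n | Bot

instance ext :: (finite) finite
proof
  have "(UNIV :: 'a ext set) = insert Top (insert Bot (range Mid))"
    by (auto, metis ext.exhaust rangeI)
  then show "finite (UNIV :: 'a ext set)"
    by (metis finite finite_imageI finite_insert)
qed

definition xpart :: "real^('n::finite ext) \<Rightarrow> real^'n" where
  "xpart z = (\<chi> i. z $ Mid i)"

definition amb_pt :: "real \<Rightarrow> real^'n::finite \<Rightarrow> real \<Rightarrow> real^('n ext)" where
  "amb_pt t x \<rho> = (\<chi> I. case I of Top \<Rightarrow> t | Mid i \<Rightarrow> x $ i | Bot \<Rightarrow> \<rho>)"

text \<open>The Fefferman--Graham normal form \<open>2\<rho> dt\<^sup>2 + 2t dt d\<rho> + t\<^sup>2 \<gamma>\<^sub>i\<^sub>j(x,\<rho>) dx\<^sup>i dx\<^sup>j\<close>.\<close>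
definition amb_metric :: "(real \<Rightarrow> 'n::finite gmat) \<Rightarrow> ('n ext) gmat" where
  "amb_metric \<gamma> z = (\<chi> I J. case (I, J) of
       (Top, Top) \<Rightarrow> 2 * z $ Bot
     | (Top, Bot) \<Rightarrow> z $ Top
     | (Bot, Top) \<Rightarrow> z $ Top
     | (Mid i, Mid j) \<Rightarrow> (z $ Top)\<^sup>2 * \<gamma> (z $ Bot) (xpart z) $ i $ j
     | _ \<Rightarrow> 0)"

text \<open>\<open>u = O(\<rho>\<^sup>m)\<close> along the cone \<open>\<rho> = 0\<close>, at points over \<open>x\<close>.\<close>
definition rho_order :: "nat \<Rightarrow> real^'n::finite \<Rightarrow> (real^('n ext) \<Rightarrow> real) \<Rightarrow> bool" where
  "rho_order m x u \<longleftrightarrow> (\<forall>j<m. \<forall>t>0. (pd Bot ^^ j) u (amb_pt t x 0) = 0)"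

text \<open>An ambient metric in normal form over the open set \<open>N\<close>, for the metric \<open>G\<close>. The curvature
  conditions, imposed over \<open>Q\<close>, are flatness in the conformally flat case (where for even \<open>n\<close>
  it selects the canonical solution), \<open>Ric = O(\<rho>\<^sup>\<infinity>)\<close> if \<open>n\<close> is odd, and
  \<open>Ric = O\<^sup>+(\<rho>\<^bsup>n/2-1\<^esup>)\<close> if \<open>n\<close> is even: \<open>O(\<rho>\<^bsup>n/2-1\<^esup>)\<close>, with the components
  \<open>tt\<close>, \<open>ti\<close> and the trace of the components \<open>ij\<close> vanishing to one order more.\<close>
definition ambient_metric :: "bool \<Rightarrow> (real^'n::finite) set \<Rightarrow> (real^'n) set \<Rightarrow> 'n gmat \<Rightarrow>
    (real \<Rightarrow> 'n gmat) \<Rightarrow> bool" where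
  "ambient_metric flat Q N G \<gamma> \<longleftrightarrow>
     (\<exists>\<Omega>. open \<Omega> \<and> (\<forall>t>0. \<forall>x\<in>N. amb_pt t x 0 \<in> \<Omega>)
        \<and> (\<forall>I J. smooth_on \<Omega> (\<lambda>z. amb_metric \<gamma> z $ I $ J))
        \<and> (\<forall>z\<in>\<Omega>. transpose (amb_metric \<gamma> z) = amb_metric \<gamma> z))
   \<and> (\<forall>x\<in>N. \<gamma> 0 x = G x)
   \<and> (\<forall>x\<in>N \<inter> Q.
        if flat then \<forall>I J K L m. rho_order m x (riem (amb_metric \<gamma>) I J K L)
        else if odd CARD('n) then \<forall>I J m. rho_order m x (ric (amb_metric \<gamma>) I J)
        else (\<forall>I J. rho_order (CARD('n) div 2 - 1) x (ric (amb_metric \<gamma>) I J))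
           \<and> rho_order (CARD('n) div 2) x (ric (amb_metric \<gamma>) Top Top)
           \<and> (\<forall>i. rho_order (CARD('n) div 2) x (ric (amb_metric \<gamma>) Top (Mid i)))
           \<and> rho_order (CARD('n) div 2) x (\<lambda>z. \<Sum>i\<in>UNIV. \<Sum>j\<in>UNIV.
               ginv G (xpart z) $ i $ j * ric (amb_metric \<gamma>) (Mid i) (Mid j) z))"

definition gjms_range :: "('m,'n::finite) cmfd \<Rightarrow> nat \<Rightarrow> bool" where
  "gjms_range X k \<longleftrightarrow> odd CARD('n) \<or> (even CARD('n) \<and> real k \<le> real CARD('n) / 2)
     \<or> conformally_flat X"

text \<open>\<open>P V\<close> is the restriction to the metric \<open>g\<close>, i.e. to \<open>t = 1\<close>, \<open>\<rho> = 0\<close>, of the \<open>k\<close>-th power of the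
  ambient Laplacian on the homogeneous extension \<open>t\<^sup>w V\<close>, \<open>w = k - n/2\<close>. By the
  Graham--Jenne--Mason--Sparling theorem the result does not depend on the choices.\<close>
definition is_gjms :: "('m,'n::finite) cmfd \<Rightarrow> nat \<Rightarrow> ('m,'n) dop \<Rightarrow> bool" where
  "is_gjms X k P \<longleftrightarrow> (let n = real CARD('n) in
     diff_op X (body X) (real k - n/2) (2*k) P
   \<and> maps_weight X (body X) (real k - n/2) (- real k - n/2) P
   \<and> (\<forall>g\<in>cclass X. \<forall>ch\<in>atlas X. \<forall>p\<in>fst ch \<inter> body X. \<exists>N \<gamma>.
        open N \<and> snd ch p \<in> N \<and> N \<subseteq> snd ch ` fst ch
      \<and> ambient_metric (conformally_flat X) (snd ch ` (fst ch \<inter> body X)) N (loc ch (g ch)) \<gamma>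
      \<and> (\<forall>V\<in>densities X (real k - n/2). P V g p =
           (laplacian (amb_metric \<gamma>) ^^ k)
             (\<lambda>z. (z $ Top) powr (real k - n/2) * loc ch (V g) (xpart z)) (amb_pt 1 (snd ch p) 0))))"


section \<open>Tractor calculus in a scale\<close>

text \<open>Tractors are expanded in the frame \<open>Y\<^sup>A\<close>, \<open>Z\<^sup>A\<^sup>i\<close>, \<open>X\<^sup>A\<close> of the splitting given by the
  scale; lower tractor indices are raised with the tractor metric. A section of \<open>\<T>\<^sup>\<Phi>[w]\<close> with \<open>r\<close>
  tractor indices becomes a function of the point and of a list of \<open>r\<close> frame indices: \<open>F x [i\<^sub>1,\<dots>,i\<^sub>r]\<close> is
  the coefficient of \<open>e\<^bsub>i\<^sub>1\<^esub> \<otimes> \<dots> \<otimes> e\<^bsub>i\<^sub>r\<^esub>\<close>. Thus \<open>\<sigma>\<close>, \<open>\<mu>\<^sub>b\<close>, \<open>\<rho>\<close> are the coefficients at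
  \<open>Top\<close>, \<open>Mid b\<close>, \<open>Bot\<close>. All weights are trivialised by the scale.\<close>

type_synonym 'n tfield = "real^'n \<Rightarrow> 'n ext list \<Rightarrow> real"

text \<open>The values \<open>h(e\<^sub>i,e\<^sub>j)\<close> of the tractor metric on the frame.\<close>
definition hgram :: "'n::finite gmat \<Rightarrow> real^'n \<Rightarrow> 'n ext \<Rightarrow> 'n ext \<Rightarrow> real" where
  "hgram G x i j = (case (i, j) of (Top, Bot) \<Rightarrow> 1 | (Bot, Top) \<Rightarrow> 1
     | (Mid a, Mid b) \<Rightarrow> ginv G x $ a $ b | _ \<Rightarrow> 0)"

text \<open>The coefficients of \<open>h\<close> as an element of \<open>\<T> \<otimes> \<T>\<close>:
  \<open>h = Y \<otimes> X + X \<otimes> Y + g\<^sub>a\<^sub>b Z\<^sup>a \<otimes> Z\<^sup>b\<close>.\<close>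
definition hcoef :: "'n::finite gmat \<Rightarrow> real^'n \<Rightarrow> 'n ext \<Rightarrow> 'n ext \<Rightarrow> real" where
  "hcoef G x i j = (case (i, j) of (Top, Bot) \<Rightarrow> 1 | (Bot, Top) \<Rightarrow> 1
     | (Mid a, Mid b) \<Rightarrow> G x $ a $ b | _ \<Rightarrow> 0)"

text \<open>\<open>\<nabla>\<^sub>a e\<^sub>i = (\<Sum>j. tconn G a j i e\<^sub>j)\<close>. Here \<open>\<nabla>\<close> acts on the frame element \<open>Z\<^sup>A\<^sup>b\<close>, for fixed \<open>b\<close>,
  by the tractor connection and not by the connection coupled to the index \<open>b\<close>; this gives the term
  in the Christoffel symbols.\<close>
definition tconn :: "'n::finite gmat \<Rightarrow> 'n \<Rightarrow> 'n ext \<Rightarrow> 'n ext \<Rightarrow> real^'n \<Rightarrow> real" where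
  "tconn G a j i x = (case (j, i) of
       (Mid b, Top) \<Rightarrow> schouten G a b x
     | (Top, Mid b) \<Rightarrow> (if a = b then - 1 else 0)
     | (Mid b, Mid c) \<Rightarrow> - chris G c a b x
     | (Bot, Mid b) \<Rightarrow> - (\<Sum>c\<in>UNIV. ginv G x $ b $ c * schouten G a c x)
     | (Mid b, Bot) \<Rightarrow> G x $ a $ b
     | _ \<Rightarrow> 0)"

definition tnabla :: "'n::finite gmat \<Rightarrow> 'n \<Rightarrow> 'n tfield \<Rightarrow> 'n tfield" where
  "tnabla G a F x is = pd a (\<lambda>y. F y is) x
     + (\<Sum>s<length is. \<Sum>i\<in>UNIV. tconn G a (is ! s) i x * F x (is[s := i]))"

definition tlaplacian :: "'n::finite gmat \<Rightarrow> 'n tfield \<Rightarrow> 'n tfield" where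
  "tlaplacian G F x is = (\<Sum>a\<in>UNIV. \<Sum>b\<in>UNIV. ginv G x $ a $ b *
     (tnabla G a (tnabla G b F) x is - (\<Sum>c\<in>UNIV. chris G c a b x * tnabla G c F x is)))"

definition tbox :: "'n::finite gmat \<Rightarrow> real \<Rightarrow> 'n tfield \<Rightarrow> 'n tfield" where
  "tbox G w F x is = tlaplacian G F x is + w * schouten_tr G x * F x is"

text \<open>The new index of \<open>D\<^sub>AV\<close> comes first.\<close>
definition tD :: "'n::finite gmat \<Rightarrow> real \<Rightarrow> 'n tfield \<Rightarrow> 'n tfield" where
  "tD G w F x is = (let n = real CARD('n) in case is of
       [] \<Rightarrow> 0
     | Top # js \<Rightarrow> w * (n + 2*w - 2) * F x js
     | Mid b # js \<Rightarrow> (n + 2*w - 2) * tnabla G b F x js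
     | Bot # js \<Rightarrow> - tbox G w F x js)"

text \<open>\<open>D\<^bsub>A\<^sub>1\<^esub> \<dots> D\<^bsub>A\<^sub>K\<^esub>V\<close> for \<open>V\<close> of weight \<open>w\<close>.\<close>
primrec tDs :: "'n::finite gmat \<Rightarrow> real \<Rightarrow> nat \<Rightarrow> 'n tfield \<Rightarrow> 'n tfield" where
  "tDs G w 0 F = F"
| "tDs G w (Suc K) F = tD G (w - real K) (tDs G w K F)"

text \<open>\<open>tcurv G a b j i\<close> is the coefficient of \<open>e\<^sub>j\<close> in \<open>\<Omega>\<^sub>a\<^sub>b e\<^sub>i\<close>.\<close>
definition tcurv :: "'n::finite gmat \<Rightarrow> 'n \<Rightarrow> 'n \<Rightarrow> 'n ext \<Rightarrow> 'n ext \<Rightarrow> real^'n \<Rightarrow> real" where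
  "tcurv G a b j i x = pd a (tconn G b j i) x - pd b (tconn G a j i) x
     + (\<Sum>l\<in>UNIV. tconn G a j l x * tconn G b l i x - tconn G b j l x * tconn G a l i x)"

text \<open>\<open>\<Omega>\<^sub>a\<^sub>b\<^sub>C\<^sub>E\<close> as a section of \<open>\<T> \<otimes> \<T>\<close>, for fixed \<open>a\<close>, \<open>b\<close>.\<close>
definition tOmega :: "'n::finite gmat \<Rightarrow> 'n \<Rightarrow> 'n \<Rightarrow> 'n tfield" where
  "tOmega G a b x is = (\<Sum>i\<in>UNIV. tcurv G a b (is ! 0) i x * hcoef G x i (is ! 1))"

text \<open>\<open>\<nabla>\<^sup>p\<Omega>\<^sub>p\<^sub>b\<^sub>C\<^sub>E\<close>, with the coupled Levi-Civita--tractor connection.\<close>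
definition tdivOmega :: "'n::finite gmat \<Rightarrow> 'n \<Rightarrow> 'n tfield" where
  "tdivOmega G b x is = (\<Sum>p\<in>UNIV. \<Sum>q\<in>UNIV. ginv G x $ p $ q *
     (tnabla G q (tOmega G p b) x is
      - (\<Sum>r\<in>UNIV. chris G r q p x * tOmega G r b x is + chris G r q b x * tOmega G p r x is)))"

definition tW :: "'n::finite gmat \<Rightarrow> 'n tfield" where
  "tW G x is = (case (is ! 0, is ! 1) of
       (Mid a, Mid b) \<Rightarrow> (real CARD('n) - 4) * tOmega G a b x [is ! 2, is ! 3]
     | (Bot, Mid b) \<Rightarrow> - tdivOmega G b x [is ! 2, is ! 3]
     | (Mid b, Bot) \<Rightarrow> tdivOmega G b x [is ! 2, is ! 3]
     | _ \<Rightarrow> 0)"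


section \<open>The operators of the Gover--Peterson formula\<close>

text \<open>Monomials in \<open>X\<close>, \<open>D\<close>, \<open>W\<close>, \<open>h\<close> with abstract indices, applied to \<open>D\<^sub>PD\<^sub>QV\<close>, which is
  written \<open>TDD P Q\<close>. Indices are natural numbers; those below the rank \<open>r\<close> of the result are free, a
  larger one occurs twice and is contracted with \<open>h\<^sup>-\<^sup>1\<close>. In \<open>TD A e\<close> the operator \<open>D\<^sub>A\<close> acts on all
  of \<open>e\<close>.\<close>
datatype texpr =
    TDD nat nat
  | TX nat
  | TW nat nat nat nat
  | Th nat nat
  | TD nat texpr
  | TMul texpr texpr

primrec tlabels :: "texpr \<Rightarrow> nat list" where
  "tlabels (TDD p q) = [p, q]"
| "tlabels (TX a) = [a]"
| "tlabels (TW a b c e) = [a, b, c, e]"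
| "tlabels (Th a b) = [a, b]"
| "tlabels (TD a e) = a # tlabels e"
| "tlabels (TMul e f) = tlabels e @ tlabels f"

primrec Wlabels :: "texpr \<Rightarrow> nat list" where
  "Wlabels (TDD p q) = []"
| "Wlabels (TX a) = []"
| "Wlabels (TW a b c e) = [a, b, c, e]"
| "Wlabels (Th a b) = []"
| "Wlabels (TD a e) = Wlabels e"
| "Wlabels (TMul e f) = Wlabels e @ Wlabels f"

primrec Wdegree :: "texpr \<Rightarrow> nat" where
  "Wdegree (TDD p q) = 0"
| "Wdegree (TX a) = 0"
| "Wdegree (TW a b c e) = 1"
| "Wdegree (Th a b) = 0"
| "Wdegree (TD a e) = Wdegree e"
| "Wdegree (TMul e f) = Wdegree e + Wdegree f"

primrec DDdegree :: "texpr \<Rightarrow> nat" where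
  "DDdegree (TDD p q) = 1"
| "DDdegree (TX a) = 0"
| "DDdegree (TW a b c e) = 0"
| "DDdegree (Th a b) = 0"
| "DDdegree (TD a e) = DDdegree e"
| "DDdegree (TMul e f) = DDdegree e + DDdegree f"

primrec tmass :: "texpr \<Rightarrow> int" where
  "tmass (TDD p q) = 2"
| "tmass (TX a) = - 1"
| "tmass (TW a b c e) = 2"
| "tmass (Th a b) = 0"
| "tmass (TD a e) = 1 + tmass e"
| "tmass (TMul e f) = tmass e + tmass f"

text \<open>The weight of the tractor obtained from \<open>V\<close> of weight \<open>w\<close>.\<close>
primrec tweight :: "real \<Rightarrow> texpr \<Rightarrow> real" where
  "tweight w (TDD p q) = w - 2"
| "tweight w (TX a) = 1"
| "tweight w (TW a b c e) = - 2"
| "tweight w (Th a b) = 0"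
| "tweight w (TD a e) = tweight w e - 1"
| "tweight w (TMul e f) = tweight w e + tweight w f"

text \<open>Before contraction: the slots are in the order of \<open>tlabels\<close>.\<close>
primrec tmono :: "'n::finite gmat \<Rightarrow> real \<Rightarrow> 'n tfield \<Rightarrow> texpr \<Rightarrow> 'n tfield" where
  "tmono G w F (TDD p q) = tDs G w 2 F"
| "tmono G w F (TX a) = (\<lambda>x is. if is = [Bot] then 1 else 0)"
| "tmono G w F (TW a b c e) = tW G"
| "tmono G w F (Th a b) = (\<lambda>x is. hcoef G x (is ! 0) (is ! 1))"
| "tmono G w F (TD a e) = tD G (tweight w e) (tmono G w F e)"
| "tmono G w F (TMul e f) = (\<lambda>x is. tmono G w F e x (take (length (tlabels e)) is)
                                    * tmono G w F f x (drop (length (tlabels e)) is))"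

text \<open>After contraction. Contracting at the end is harmless, since \<open>h\<close> is parallel of weight \<open>0\<close>
  and so commutes with \<open>D\<close>.\<close>
definition tmono_contr :: "'n::finite gmat \<Rightarrow> real \<Rightarrow> 'n tfield \<Rightarrow> nat \<Rightarrow> texpr \<Rightarrow> 'n tfield" where
  "tmono_contr G w F r e x js = (let l = tlabels e; L = length l in
     \<Sum>is | length is = L \<and> (\<forall>s<L. l ! s < r \<longrightarrow> is ! s = js ! (l ! s)).
       tmono G w F e x is *
       (\<Prod>(s, s') \<in> {(s, s'). s < s' \<and> s' < L \<and> l ! s = l ! s' \<and> r \<le> l ! s}.
          hgram G x (is ! s) (is ! s')))"

text \<open>A polynomial is a list of monomials with coefficients that are rational functions of \<open>n\<close>,
  given by numerator and denominator.\<close>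
type_synonym tpoly = "((rat poly \<times> rat poly) \<times> texpr) list"

definition coef_at :: "nat \<Rightarrow> rat poly \<times> rat poly \<Rightarrow> real" where
  "coef_at n c = of_rat (poly (fst c) (of_nat n) / poly (snd c) (of_nat n))"

definition tpoly_op :: "'n::finite gmat \<Rightarrow> real \<Rightarrow> 'n tfield \<Rightarrow> nat \<Rightarrow> tpoly \<Rightarrow> 'n tfield" where
  "tpoly_op G w F r \<Psi> x js = (\<Sum>(c, e)\<leftarrow>\<Psi>. coef_at CARD('n) c * tmono_contr G w F r e x js)"

definition gp_term :: "nat \<Rightarrow> texpr \<Rightarrow> bool" where
  "gp_term k e \<longleftrightarrow> DDdegree e = 1 \<and> Wdegree e \<ge> 1
   \<and> tmass e = int k + 1 \<and> (\<forall>w. tweight w e = w - real k - 1)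
   \<and> (\<forall>l<k - 1. count_list (tlabels e) l = 1)
   \<and> (\<forall>l\<in>set (tlabels e). k - 1 \<le> l \<longrightarrow> count_list (tlabels e) l = 2)
   \<and> (\<exists>l\<in>set (Wlabels e). l < k - 1)"

definition scalar :: "(real^'n \<Rightarrow> real) \<Rightarrow> 'n::finite tfield" where
  "scalar f = (\<lambda>x is. if is = [] then f x else 0)"

text \<open>\<open>\<Psi>\<close> gives the operator \<open>\<P>\<^sup>k\<close> in the formula
  \<open>(-1)\<^bsup>k-1\<^esup> X\<^bsub>A\<^sub>1\<^esub> \<dots> X\<^bsub>A\<^bsub>k-1\<^esub>\<^esub> P\<^sub>2\<^sub>k V = \<box> D\<^bsub>A\<^sub>1\<^esub> \<dots> D\<^bsub>A\<^bsub>k-1\<^esub>\<^esub> V + \<P>\<^sup>k V\<close>.\<close>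
definition gover_peterson ::
    "('m,'n::finite) cmfd \<Rightarrow> nat \<Rightarrow> ('m,'n) dop \<Rightarrow> tpoly \<Rightarrow> bool" where
  "gover_peterson X k P \<Psi> \<longleftrightarrow> (let n = real CARD('n); w = real k - n/2 in
     (if k \<le> 2 \<or> conformally_flat X then \<Psi> = []
      else \<forall>(c, e)\<in>set \<Psi>. poly (snd c) (of_nat CARD('n)) \<noteq> 0 \<and> gp_term k e)
   \<and> (\<forall>g\<in>cclass X. \<forall>V\<in>densities X w. \<forall>ch\<in>atlas X. \<forall>p\<in>fst ch \<inter> body X.
        \<forall>js. length js = k - 1 \<longrightarrow>
          (let G = loc ch (g ch); F = scalar (loc ch (V g)); x = snd ch p in
           (- 1) ^ (k - 1) * (if js = replicate (k - 1) Bot then P V g p else 0)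
           = tbox G (w - real (k - 1)) (tDs G w (k - 1) F) x js + tpoly_op G w F (k - 1) \<Psi> x js)))"


section \<open>The boundary operators\<close>

text \<open>\<open>N\<^sup>A = n\<^sub>b Z\<^sup>A\<^sup>b - H X\<^sup>A\<close>.\<close>
definition normal_tractor :: "'n::finite gmat \<Rightarrow> (real^'n \<Rightarrow> real) \<Rightarrow> real^'n \<Rightarrow> 'n ext \<Rightarrow> real" where
  "normal_tractor G t x i =
     (case i of Top \<Rightarrow> 0 | Mid b \<Rightarrow> conormal G t b x | Bot \<Rightarrow> - mean_curv G t x)"

text \<open>\<open>N\<^sup>A\<^sup>1 \<dots> N\<^sup>A\<^sup>r F\<^sub>A\<^sub>1\<^sub>\<dots>\<^sub>A\<^sub>r\<close>, contracting the first \<open>r\<close> indices.\<close>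
definition N_contract ::
    "'n::finite gmat \<Rightarrow> (real^'n \<Rightarrow> real) \<Rightarrow> nat \<Rightarrow> 'n tfield \<Rightarrow> 'n tfield" where
  "N_contract G t r F x js = (\<Sum>is | length is = r.
     (\<Prod>i\<leftarrow>is. \<Sum>j\<in>UNIV. normal_tractor G t x j * hgram G x j i) * F x (is @ js))"

definition tdelta ::
    "'n::finite gmat \<Rightarrow> (real^'n \<Rightarrow> real) \<Rightarrow> real \<Rightarrow> 'n tfield \<Rightarrow> 'n tfield" where
  "tdelta G t w F x is = (\<Sum>a\<in>UNIV. \<Sum>b\<in>UNIV. ginv G x $ a $ b * conormal G t b x * tnabla G a F x is)
     - w * mean_curv G t x * F x is"

definition delta_K ::
    "'n::finite gmat \<Rightarrow> (real^'n \<Rightarrow> real) \<Rightarrow> nat \<Rightarrow> real \<Rightarrow> 'n tfield \<Rightarrow> 'n tfield" where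
  "delta_K G t K w F =
     N_contract G t (K - 1) (tdelta G t (w - real (K - 1)) (tDs G w (K - 1) F))"

text \<open>\<open>P\<^bsub>A\<^sub>1\<dots>A\<^sub>k\<^esub>V = D\<^bsub>A\<^sub>1\<^esub> \<dots> D\<^bsub>A\<^sub>k\<^esub>V - X\<^bsub>A\<^sub>1\<^esub> \<P>\<^sup>k\<^bsub>A\<^sub>2\<dots>A\<^sub>k\<^esub>V\<close>.\<close>
definition P_tractor :: "'n::finite gmat \<Rightarrow> tpoly \<Rightarrow> nat \<Rightarrow> real \<Rightarrow> 'n tfield \<Rightarrow> 'n tfield" where
  "P_tractor G \<Psi> k w F x is = tDs G w k F x is
     - (if hd is = Bot then tpoly_op G w F (k - 1) \<Psi> x (tl is) else 0)"

text \<open>\<open>N\<^bsup>A\<^sub>1\<^esup> \<dots> N\<^bsup>A\<^sub>k\<^esup> \<delta>\<^sub>J P\<^bsub>A\<^sub>1\<dots>A\<^sub>k\<^esub>V\<close>.\<close>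
definition delta_P :: "'n::finite gmat \<Rightarrow> (real^'n \<Rightarrow> real) \<Rightarrow> tpoly \<Rightarrow> nat \<Rightarrow> nat \<Rightarrow> real \<Rightarrow>
    'n tfield \<Rightarrow> 'n tfield" where
  "delta_P G t \<Psi> J k w F =
     N_contract G t k (delta_K G t J (w - real k) (P_tractor G \<Psi> k w F))"

text \<open>\<open>v\<close> is the value at \<open>w\<close> of the polynomial \<open>q\<close> with \<open>c q = F\<close>, where \<open>F\<close> is polynomial in the weight.\<close>
definition poly_continuation :: "(real \<Rightarrow> real) \<Rightarrow> (real \<Rightarrow> real) \<Rightarrow> real \<Rightarrow> real \<Rightarrow> bool" where
  "poly_continuation c F w v \<longleftrightarrow> (\<exists>q. (\<forall>w'. c w' * poly q w' = F w') \<and> v = poly q w)"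

text \<open>\<open>B\<close> is given at all points of the boundary by the local formula \<open>\<Phi> G t f x\<close> with value \<open>v\<close>, where
  \<open>G\<close>, \<open>t\<close>, \<open>f\<close>, \<open>x\<close> are the coordinate expressions of the metric, of a defining function, of the
  density in the scale of the metric and of the point. In particular, the polynomial
  continuations below are taken with the function representing the density in a scale held fixed.\<close>
definition given_by :: "('m::topological_space,'n::finite) cmfd \<Rightarrow> real \<Rightarrow> ('m,'n) dop \<Rightarrow>
    ('n gmat \<Rightarrow> (real^'n \<Rightarrow> real) \<Rightarrow> (real^'n \<Rightarrow> real) \<Rightarrow> real^'n \<Rightarrow> real \<Rightarrow> bool) \<Rightarrow> bool" where
  "given_by X w B \<Phi> \<longleftrightarrow> (\<forall>V\<in>densities X w. \<forall>g\<in>cclass X. \<forall>p\<in>bdry X. \<forall>U t.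
     defining_function X p U t \<longrightarrow> (\<forall>ch\<in>atlas X. p \<in> fst ch \<longrightarrow>
       \<Phi> (loc ch (g ch)) (loc ch t) (loc ch (V g)) (snd ch p) (B V g p)))"

definition is_delta ::
    "('m::topological_space,'n::finite) cmfd \<Rightarrow> real \<Rightarrow> nat \<Rightarrow> ('m,'n) dop \<Rightarrow> bool" where
  "is_delta X w K B \<longleftrightarrow> K \<ge> 1 \<and>
     given_by X w B (\<lambda>G t f x v. v = delta_K G t K w (scalar f) x [])"

definition is_delta0 ::
    "('m::topological_space,'n::finite) cmfd \<Rightarrow> real \<Rightarrow> nat \<Rightarrow> ('m,'n) dop \<Rightarrow> bool" where
  "is_delta0 X w K B \<longleftrightarrow> K \<ge> 1 \<and> conformally_flat X \<and>
     given_by X w B (\<lambda>G t f x v. poly_continuation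
       (\<lambda>w'. \<Prod>j=1..(K - 1) div 2. real CARD('n) + 2*w' - 2 * real K + 2 * real j)
       (\<lambda>w'. delta_K G t K w' (scalar f) x []) w v)"

definition is_delta_Jk :: "('m::topological_space,'n::finite) cmfd \<Rightarrow> (nat \<Rightarrow> tpoly) \<Rightarrow> real \<Rightarrow>
    nat \<Rightarrow> nat \<Rightarrow> ('m,'n) dop \<Rightarrow> bool" where
  "is_delta_Jk X \<Psi> w J k B \<longleftrightarrow> J \<ge> 1 \<and> k \<ge> 1 \<and> gjms_range X k \<and>
     given_by X w B (\<lambda>G t f x v.
       if k \<le> J then v = delta_P G t (\<Psi> k) J k w (scalar f) x []
       else poly_continuation (\<lambda>w'. real CARD('n) + 2*w' - 2 * real k)
              (\<lambda>w'. delta_P G t (\<Psi> k) J k w' (scalar f) x []) w v)"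

text \<open>The possible choices of \<open>\<delta>\<^sup>T\<^sub>i\<close>, \<open>i \<ge> 0\<close>, on densities of weight \<open>w\<close>.\<close>
definition is_deltaT :: "('m::topological_space,'n::finite) cmfd \<Rightarrow> (nat \<Rightarrow> tpoly) \<Rightarrow> real \<Rightarrow>
    nat \<Rightarrow> ('m,'n) dop \<Rightarrow> bool" where
  "is_deltaT X \<Psi> w i B \<longleftrightarrow>
     (if i = 0 then \<forall>V\<in>densities X w. \<forall>g\<in>cclass X. \<forall>p\<in>bdry X. B V g p = V g p
      else maps_weight X (bdry X) w (w - real i) B
         \<and> (is_delta X w i B \<or> is_delta0 X w i B
            \<or> (\<exists>J k. J + k = i \<and> is_delta_Jk X \<Psi> w J k B))
         \<and> has_order X (bdry X) w i B \<and> has_transverse_order X w i B)"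

end

theory Submission
  imports Defs
begin

text \<open>The condition concerns leading symbols along lines \<open>\<eta> + \<tau>\<nu>\<close>, with \<open>\<nu>\<close> the unit conormal. It comes down
to a comparison of degrees in \<open>\<tau>\<close>.

\<^item> The symbol of \<open>P\<^sub>2\<^sub>k\<close> at \<open>\<xi>\<close> is \<open>(g\<^sup>-\<^sup>1(\<xi>,\<xi>))\<^sup>k\<close> (\<open>symb_gjms\<close>): it is read off by applying \<open>P\<^sub>2\<^sub>k\<close> to
  a density which is a multiple of \<open>f\<^sup>2\<^sup>k\<close>, with \<open>f\<close> vanishing at the point and \<open>df = \<xi>\<close> there. Each of
  the \<open>k\<close> ambient Laplacians lowers the power of \<open>f\<close> by two and multiplies the leading coefficient by
  the ambient inverse metric on \<open>df\<close>, which is \<open>g\<^sup>-\<^sup>1(\<xi>,\<xi>)\<close> on the cone, as \<open>f\<close> does not involve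
  the extra coordinates. On the line the symbol is the \<open>k\<close>-th power of a real monic
  quadratic polynomial without real zeros, hence \<open>k\<close> zeros lie in each open half plane
  (\<open>labelled_zeros_quadratic_power\<close>).

\<^item> An operator of order \<open>i\<close> has a symbol whose restriction to the line has degree at most \<open>i\<close> in \<open>\<tau>\<close>,
  and the coefficient of \<open>\<tau>\<^sup>i\<close> is the symbol at the conormal. Transverse order \<open>i\<close> says that this
  coefficient is not zero (\<open>symb_transverse_nonzero\<close>). So the symbols of
  \<open>\<delta>\<^sup>T\<^sub>0, \<dots>, \<delta>\<^sup>T\<^bsub>k-1\<^esub>\<close> are polynomials of degrees exactly \<open>0, \<dots>, k - 1\<close>. A nontrivial linear
  combination of them is a nonzero polynomial of degree less than \<open>k\<close>, hence not divisible by
  \<open>\<Prod>(\<tau> - \<tau>\<^sub>i\<^sup>+)\<close>, which has degree \<open>k\<close> (\<open>independent_mod_degrees\<close>).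

The rest is calculus: closure properties of smooth functions, a cutoff function to produce
enough globally defined densities, and the effect of differential operators on functions \<open>f\<^sup>m v\<close>.\<close>

section \<open>Partial derivatives and smooth functions\<close>

lemma pd_eqI: "(f has_derivative f') (at x) \<Longrightarrow> pd i f x = f' (axis i 1)"
  unfolding pd_def by (metis frechet_derivative_at)

lemma has_derivative_frechet:
  "f differentiable (at x) \<Longrightarrow> (f has_derivative frechet_derivative f (at x)) (at x)"
  using frechet_derivative_works by blast

lemma differentiable_cong_open:
  assumes "f differentiable (at x)" "open S" "x \<in> S" "\<And>y. y \<in> S \<Longrightarrow> f y = g y"
  shows "g differentiable (at x)"
  using has_derivative_transform_within_open[OF has_derivative_frechet[OF assms(1)] assms(2-4)]
  unfolding differentiable_def by blast

lemma pd_cong: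
  assumes "open S" "x \<in> S" "\<And>y. y \<in> S \<Longrightarrow> f y = g y"
  shows "pd i f x = pd i g x"
proof -
  have "(f has_derivative D) (at x) \<longleftrightarrow> (g has_derivative D) (at x)" for D
    using has_derivative_transform_within_open[OF _ assms(1,2), of f D UNIV g]
      has_derivative_transform_within_open[OF _ assms(1,2), of g D UNIV f] assms(3)
    by auto
  then show ?thesis by (simp add: pd_def frechet_derivative_def)
qed

lemma pds_cong:
  assumes "open S" "x \<in> S" "\<And>y. y \<in> S \<Longrightarrow> f y = g y"
  shows "pds l f x = pds l g x"
  using assms(2)
proof (induction l arbitrary: x)
  case Nil
  then show ?case using assms(3) by simp
next
  case (Cons i l)
  then show ?case using pd_cong[OF assms(1), of x "pds l f" "pds l g" i] by simp
qed

lemma pd_add: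
  assumes "f differentiable (at x)" "g differentiable (at x)"
  shows "pd i (\<lambda>x. f x + g x) x = pd i f x + pd i g x"
  using pd_eqI[OF has_derivative_add[OF assms[THEN has_derivative_frechet]]]
  by (simp add: pd_def)

lemma pd_mult:
  assumes "f differentiable (at x)" "g differentiable (at x)"
  shows "pd i (\<lambda>x. f x * g x) x = f x * pd i g x + pd i f x * g x"
  using pd_eqI[OF has_derivative_mult[OF assms[THEN has_derivative_frechet]]]
  by (simp add: pd_def)

lemma real_comp_has_derivative:
  assumes "f differentiable (at x)" "(\<phi> has_real_derivative d) (at (f x))"
  shows "((\<lambda>x. \<phi> (f x)) has_derivative (\<lambda>v. d * frechet_derivative f (at x) v)) (at x)"
  using has_derivative_compose[OF has_derivative_frechet[OF assms(1)], of \<phi> "(*) d"] assms(2)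
  by (simp add: has_field_derivative_def)

lemma comp_has_derivative:
  fixes u :: "real^'n::finite \<Rightarrow> real^'m::finite"
  assumes "\<And>i. (\<lambda>y. u y $ i) differentiable (at x)" "F differentiable (at (u x))"
  shows "((\<lambda>y. F (u y)) has_derivative
     (\<lambda>v. \<Sum>i\<in>UNIV. pd i F (u x) * frechet_derivative (\<lambda>y. u y $ i) (at x) v)) (at x)"
proof -
  let ?D = "\<lambda>v. \<chi> i. frechet_derivative (\<lambda>y. u y $ i) (at x) v"
  have "(u has_derivative ?D) (at x)"
    unfolding has_derivative_componentwise_within[of u]
    using has_derivative_frechet[OF assms(1)] by (auto simp: Basis_vec_def inner_axis)
  then have *: "((\<lambda>y. F (u y)) has_derivative (\<lambda>v. frechet_derivative F (at (u x)) (?D v))) (at x)"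
    using has_derivative_compose has_derivative_frechet[OF assms(2)] by blast
  have lin: "linear (frechet_derivative F (at (u x)))"
    using assms(2) linear_frechet_derivative by blast
  have "frechet_derivative F (at (u x)) v = (\<Sum>i\<in>UNIV. pd i F (u x) * v $ i)" for v
  proof -
    have "frechet_derivative F (at (u x)) v
        = frechet_derivative F (at (u x)) (\<Sum>i\<in>UNIV. v $ i *\<^sub>R axis i 1)"
      using basis_expansion[of v] by (simp add: scalar_mult_eq_scaleR)
    also have "\<dots> = (\<Sum>i\<in>UNIV. pd i F (u x) * v $ i)"
      by (simp add: linear_sum[OF lin] linear_cmul[OF lin] pd_def mult.commute)
    finally show ?thesis .
  qed
  then show ?thesis using * by simp
qed

lemma smooth_on_differentiable:
  "smooth_on S f \<Longrightarrow> x \<in> S \<Longrightarrow> f differentiable (at x)"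
  unfolding smooth_on_def by (metis foldr_Nil id_apply)

lemma smooth_on_pd: "smooth_on S f \<Longrightarrow> smooth_on S (pd i f)"
  unfolding smooth_on_def
proof safe
  fix l x assume "\<forall>l. \<forall>x\<in>S. pds l f differentiable at x" "x \<in> S"
  then have "pds (l @ [i]) f differentiable at x" by blast
  then show "pds l (pd i f) differentiable at x" by simp
qed

lemma smooth_on_subset: "smooth_on S f \<Longrightarrow> S' \<subseteq> S \<Longrightarrow> smooth_on S' f"
  unfolding smooth_on_def by blast

lemma smooth_on_Un: "smooth_on S f \<Longrightarrow> smooth_on S' f \<Longrightarrow> smooth_on (S \<union> S') f"
  unfolding smooth_on_def by blast

lemma smooth_on_cong:
  assumes "open S" "\<And>x. x \<in> S \<Longrightarrow> f x = g x" "smooth_on S f"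
  shows "smooth_on S g"
  unfolding smooth_on_def
proof safe
  fix l x assume "x \<in> S"
  then have "pds l f differentiable at x" using assms(3) by (auto simp: smooth_on_def)
  moreover have "pds l f y = pds l g y" if "y \<in> S" for y
    using pds_cong[OF assms(1) that] assms(2) by blast
  ultimately show "pds l g differentiable at x"
    using differentiable_cong_open[OF _ assms(1) \<open>x \<in> S\<close>] by blast
qed

lemma pds_const: "\<exists>d. pds l (\<lambda>_. c) = (\<lambda>_. d)"
proof (induction l)
  case (Cons i l)
  then obtain d where "pds l (\<lambda>_. c) = (\<lambda>_. d)" by blast
  then have "pds (i # l) (\<lambda>_. c) = (\<lambda>_. 0)"
    by (auto simp: pd_def)
  then show ?case by blast
qed auto

lemma smooth_on_const [simp]: "smooth_on S (\<lambda>_. c)"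
  unfolding smooth_on_def
proof safe
  fix l x
  show "pds l (\<lambda>_. c) differentiable at x"
    using pds_const[of l c] by auto
qed

lemma pd_coordinate: "pd i (\<lambda>x::real^'n::finite. x $ j) = (\<lambda>_. if i = j then 1 else 0)"
proof
  fix x :: "real^'n"
  have "((\<lambda>x. x $ j) has_derivative (\<lambda>x. x $ j)) (at x)"
    by (rule bounded_linear_imp_has_derivative[OF bounded_linear_vec_nth])
  then show "pd i (\<lambda>x. x $ j) x = (if i = j then 1 else 0)"
    using pd_eqI[of "\<lambda>x. x $ j" "\<lambda>x. x $ j" x i] by (auto simp: axis_def)
qed

lemma smooth_on_coordinate [simp]: "smooth_on S (\<lambda>x::real^'n::finite. x $ j)"
  unfolding smooth_on_def
proof safe
  fix l and x :: "real^'n"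
  show "pds l (\<lambda>x. x $ j) differentiable at x"
  proof (cases l rule: rev_cases)
    case Nil
    then show ?thesis
      using bounded_linear_imp_differentiable[OF bounded_linear_vec_nth] by auto
  next
    case (snoc l' i)
    then show ?thesis
      using pds_const[of l' "if i = j then 1 else 0"] by (auto simp: pd_coordinate)
  qed
qed

text \<open>The smooth functions on \<open>S\<close>, together with the pullbacks along \<open>u\<close> of smooth functions on \<open>T\<close>, generate
this set of functions under the operations for which smoothness is to be shown. It is stable
under partial derivatives, since \<open>real_comp\<close> comes with all derivatives of the outer function; as
its members are differentiable, they are smooth. This treats all closure properties by a single
induction, without a formula for iterated derivatives.\<close>
inductive smooth_algebra :: "(real^'n::finite) set \<Rightarrow> (real^'m::finite) set \<Rightarrow>
    (real^'n \<Rightarrow> real^'m) \<Rightarrow> (real^'n \<Rightarrow> real) \<Rightarrow> bool" for S T u where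
  base: "smooth_on S f \<Longrightarrow> smooth_algebra S T u f"
| pullback: "smooth_on T F \<Longrightarrow> smooth_algebra S T u (\<lambda>x. F (u x))"
| add: "smooth_algebra S T u f \<Longrightarrow> smooth_algebra S T u g \<Longrightarrow> smooth_algebra S T u (\<lambda>x. f x + g x)"
| mult: "smooth_algebra S T u f \<Longrightarrow> smooth_algebra S T u g \<Longrightarrow> smooth_algebra S T u (\<lambda>x. f x * g x)"
| real_comp: "smooth_algebra S T u f \<Longrightarrow>
    (\<And>k x. x \<in> S \<Longrightarrow> (\<phi> k has_real_derivative \<phi> (Suc k) (f x)) (at (f x))) \<Longrightarrow>
    smooth_algebra S T u (\<lambda>x. \<phi> (0::nat) (f x))"

lemma smooth_algebra_sum:
  assumes "\<And>i. i \<in> I \<Longrightarrow> smooth_algebra S T u (f i)"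
  shows "smooth_algebra S T u (\<lambda>x. \<Sum>i\<in>I. f i x)"
  using assms
proof (induction I rule: infinite_finite_induct)
  case (insert i I)
  then show ?case
    using smooth_algebra.add[of S T u "f i" "\<lambda>x. \<Sum>i\<in>I. f i x"] by simp
qed (simp_all add: smooth_algebra.base)

lemma smooth_algebra_pd:
  assumes u: "\<And>i. smooth_on S (\<lambda>x. u x $ i)" "u ` S \<subseteq> T"
    and "smooth_algebra S T u f"
  shows "(\<forall>x\<in>S. f differentiable (at x)) \<and>
    (\<forall>i. \<exists>g. smooth_algebra S T u g \<and> (\<forall>x\<in>S. pd i f x = g x))"
  using assms(3)
proof (induction rule: smooth_algebra.induct)
  case (base f)
  then show ?case
    using smooth_on_differentiable smooth_on_pd smooth_algebra.base by blast
next
  case (pullback F)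
  have d: "((\<lambda>y. F (u y)) has_derivative
     (\<lambda>v. \<Sum>i\<in>UNIV. pd i F (u x) * frechet_derivative (\<lambda>y. u y $ i) (at x) v)) (at x)"
    if "x \<in> S" for x
    using that u pullback by (intro comp_has_derivative) (auto intro: smooth_on_differentiable)
  have "smooth_algebra S T u (\<lambda>x. \<Sum>i\<in>UNIV. pd i F (u x) * pd j (\<lambda>y. u y $ i) x)" for j
    using pullback u(1)
    by (intro smooth_algebra_sum smooth_algebra.mult smooth_algebra.pullback[of T "pd _ F"]
        smooth_algebra.base smooth_on_pd)
  moreover have "pd j (\<lambda>y. F (u y)) x = (\<Sum>i\<in>UNIV. pd i F (u x) * pd j (\<lambda>y. u y $ i) x)"
    if "x \<in> S" for x j
    using pd_eqI[OF d[OF that]] by (simp add: pd_def)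
  ultimately show ?case using d unfolding differentiable_def by blast
next
  case (add f g)
  have "\<exists>h. smooth_algebra S T u h \<and> (\<forall>x\<in>S. pd i (\<lambda>x. f x + g x) x = h x)" for i
  proof -
    obtain f' g' where "smooth_algebra S T u f'" "\<forall>x\<in>S. pd i f x = f' x"
      "smooth_algebra S T u g'" "\<forall>x\<in>S. pd i g x = g' x"
      using add by meson
    then show ?thesis
      using add by (intro exI[of _ "\<lambda>x. f' x + g' x"]) (auto simp: pd_add intro: smooth_algebra.add)
  qed
  then show ?case using add by auto
next
  case (mult f g)
  have "\<exists>h. smooth_algebra S T u h \<and> (\<forall>x\<in>S. pd i (\<lambda>x. f x * g x) x = h x)" for i
  proof -
    obtain f' g' where "smooth_algebra S T u f'" "\<forall>x\<in>S. pd i f x = f' x"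
      "smooth_algebra S T u g'" "\<forall>x\<in>S. pd i g x = g' x"
      using mult by meson
    then show ?thesis
      using mult by (intro exI[of _ "\<lambda>x. f x * g' x + f' x * g x"])
        (auto simp: pd_mult intro!: smooth_algebra.add smooth_algebra.mult)
  qed
  then show ?case using mult by auto
next
  case (real_comp f \<phi>)
  have d: "((\<lambda>x. \<phi> 0 (f x)) has_derivative (\<lambda>v. \<phi> 1 (f x) * frechet_derivative f (at x) v)) (at x)"
    if "x \<in> S" for x
    using real_comp_has_derivative[of f x "\<phi> 0"] real_comp(2)[of x 0] real_comp(3) that by auto
  have "\<exists>h. smooth_algebra S T u h \<and> (\<forall>x\<in>S. pd i (\<lambda>x. \<phi> 0 (f x)) x = h x)" for i
  proof -
    obtain f' where f': "smooth_algebra S T u f'" "\<forall>x\<in>S. pd i f x = f' x"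
      using real_comp by meson
    have "smooth_algebra S T u (\<lambda>x. \<phi> 1 (f x))"
      using smooth_algebra.real_comp[OF real_comp(1), of "\<lambda>k. \<phi> (Suc k)"] real_comp(2) by simp
    moreover have "pd i (\<lambda>x. \<phi> 0 (f x)) x = \<phi> 1 (f x) * f' x" if "x \<in> S" for x
      using pd_eqI[OF d[OF that]] f'(2) that by (simp add: pd_def)
    ultimately show ?thesis
      using f'(1) smooth_algebra.mult by (intro exI[of _ "\<lambda>x. \<phi> 1 (f x) * f' x"]) auto
  qed
  then show ?case using d unfolding differentiable_def by blast
qed

lemma smooth_algebra_smooth_on:
  assumes "open S" and u: "\<And>i. smooth_on S (\<lambda>x. u x $ i)" "u ` S \<subseteq> T"
    and f: "smooth_algebra S T u f"
  shows "smooth_on S f"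
proof -
  have ex: "\<exists>g. smooth_algebra S T u g \<and> (\<forall>x\<in>S. pds l f x = g x)" for l
  proof (induction l)
    case Nil
    show ?case by (rule exI[of _ f]) (simp add: f)
  next
    case (Cons i l)
    from Cons.IH obtain g where g: "smooth_algebra S T u g \<and> (\<forall>x\<in>S. pds l f x = g x)" ..
    from smooth_algebra_pd[OF u conjunct1[OF g]]
    obtain h where h: "smooth_algebra S T u h \<and> (\<forall>x\<in>S. pd i g x = h x)" by blast
    have "pd i (pds l f) x = pd i g x" if "x \<in> S" for x
      using g by (intro pd_cong[OF assms(1) that]) simp
    then show ?case using h by (intro exI[of _ h]) simp
  qed
  show ?thesis
    unfolding smooth_on_def
  proof safe
    fix l x assume x: "x \<in> S"
    from ex[of l] obtain g where g: "smooth_algebra S T u g \<and> (\<forall>x\<in>S. pds l f x = g x)" ..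
    have "g differentiable (at x)" using smooth_algebra_pd[OF u conjunct1[OF g]] x by blast
    then show "pds l f differentiable (at x)"
      by (rule differentiable_cong_open[OF _ assms(1) x]) (simp add: g)
  qed
qed

lemma smooth_on_compose:
  assumes "open S" "\<And>i. smooth_on S (\<lambda>x. u x $ i)" "u ` S \<subseteq> T" "smooth_on T F"
  shows "smooth_on S (\<lambda>x. F (u x))"
  by (rule smooth_algebra_smooth_on[OF assms(1-3)]) (rule smooth_algebra.pullback[OF assms(4)])

text \<open>For closure properties in which no map between different spaces occurs, \<open>u\<close> is the identity.\<close>
lemma smooth_algebra_id_smooth_on:
  assumes "open S" "smooth_algebra S UNIV (\<lambda>x. x) f"
  shows "smooth_on S f"
  by (rule smooth_algebra_smooth_on[OF assms(1) _ _ assms(2)]) auto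

lemma smooth_on_add:
  "open S \<Longrightarrow> smooth_on S f \<Longrightarrow> smooth_on S g \<Longrightarrow> smooth_on S (\<lambda>x. f x + g x)"
  by (rule smooth_algebra_id_smooth_on, assumption)
    (rule smooth_algebra.add; erule smooth_algebra.base)

lemma smooth_on_mult:
  "open S \<Longrightarrow> smooth_on S f \<Longrightarrow> smooth_on S g \<Longrightarrow> smooth_on S (\<lambda>x. f x * g x)"
  by (rule smooth_algebra_id_smooth_on, assumption)
    (rule smooth_algebra.mult; erule smooth_algebra.base)

lemma smooth_on_real_comp:
  assumes "open S" "smooth_on S f"
    "\<And>k x. x \<in> S \<Longrightarrow> (\<phi> k has_real_derivative \<phi> (Suc k) (f x)) (at (f x))"
  shows "smooth_on S (\<lambda>x. \<phi> (0::nat) (f x))"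
  by (rule smooth_algebra_id_smooth_on[OF assms(1)])
    (rule smooth_algebra.real_comp[where \<phi> = \<phi>, OF smooth_algebra.base[OF assms(2)] assms(3)])

lemma smooth_on_uminus: "open S \<Longrightarrow> smooth_on S f \<Longrightarrow> smooth_on S (\<lambda>x. - f x)"
  using smooth_on_mult[of S "\<lambda>_. -1" f] by simp

lemma smooth_on_diff:
  "open S \<Longrightarrow> smooth_on S f \<Longrightarrow> smooth_on S g \<Longrightarrow> smooth_on S (\<lambda>x. f x - g x)"
  using smooth_on_add[of S f "\<lambda>x. - g x"] smooth_on_uminus[of S g] by simp

lemma smooth_on_sum:
  "open S \<Longrightarrow> (\<And>i. i \<in> I \<Longrightarrow> smooth_on S (f i)) \<Longrightarrow> smooth_on S (\<lambda>x. \<Sum>i\<in>I. f i x)"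
  by (rule smooth_algebra_id_smooth_on, assumption)
    (rule smooth_algebra_sum, rule smooth_algebra.base, blast)

lemma smooth_on_prod:
  assumes "open S" "\<And>i. i \<in> I \<Longrightarrow> smooth_on S (f i)"
  shows "smooth_on S (\<lambda>x. \<Prod>i\<in>I. f i x)"
  using assms(2)
proof (induction I rule: infinite_finite_induct)
  case (insert i I)
  then show ?case
    using smooth_on_mult[OF assms(1), of "f i" "\<lambda>x. \<Prod>i\<in>I. f i x"] by simp
qed simp_all

lemma smooth_on_power: "open S \<Longrightarrow> smooth_on S f \<Longrightarrow> smooth_on S (\<lambda>x. f x ^ k)"
  using smooth_on_prod[of S "{..<k}" "\<lambda>_. f"] by simp

lemma smooth_on_exp: "open S \<Longrightarrow> smooth_on S f \<Longrightarrow> smooth_on S (\<lambda>x. exp (f x))"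
  using smooth_on_real_comp[of S f "\<lambda>_. exp"] DERIV_exp by blast

lemma smooth_on_powr:
  assumes "open S" "smooth_on S f" "\<And>x. x \<in> S \<Longrightarrow> f x > 0"
  shows "smooth_on S (\<lambda>x. f x powr c)"
proof -
  (* The derivatives of y powr c, in order. *)
  define \<phi> where "\<phi> = (\<lambda>k y. (\<Prod>j<k. c - real j) * y powr (c - real k))"
  have "(\<phi> k has_real_derivative \<phi> (Suc k) y) (at y)" if "y > 0" for k y
  proof -
    have "(\<phi> k has_real_derivative (\<Prod>j<k. c - real j) * ((c - real k) * y powr (c - real k - 1))) (at y)"
      unfolding \<phi>_def using that by (auto intro!: derivative_eq_intros)
    then show ?thesis by (simp add: \<phi>_def algebra_simps)
  qed
  then have "smooth_on S (\<lambda>x. \<phi> 0 (f x))"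
    using smooth_on_real_comp[OF assms(1,2), of \<phi>] assms(3) by blast
  then show ?thesis by (simp add: \<phi>_def)
qed

lemma smooth_on_inverse:
  assumes "open S" "smooth_on S f" "\<And>x. x \<in> S \<Longrightarrow> f x \<noteq> 0"
  shows "smooth_on S (\<lambda>x. inverse (f x))"
proof -
  define \<phi> where "\<phi> = (\<lambda>k y::real. (\<Prod>j<k. - real (Suc j)) * inverse y ^ Suc k)"
  have "(\<phi> k has_real_derivative \<phi> (Suc k) y) (at y)" if "y \<noteq> 0" for k y
  proof -
    have "((\<lambda>y. inverse y ^ Suc k) has_real_derivative
        real (Suc k) * inverse y ^ k * (- (inverse y ^ 2))) (at y)"
      using DERIV_power[OF DERIV_inverse[OF that], of "Suc k"]
      by (simp add: power2_eq_square algebra_simps)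
    then have "(\<phi> k has_real_derivative
        (\<Prod>j<k. - real (Suc j)) * (real (Suc k) * inverse y ^ k * (- (inverse y ^ 2)))) (at y)"
      unfolding \<phi>_def by (rule DERIV_cmult)
    then show ?thesis by (simp add: \<phi>_def algebra_simps power2_eq_square)
  qed
  then have "smooth_on S (\<lambda>x. \<phi> 0 (f x))"
    using smooth_on_real_comp[OF assms(1,2), of \<phi>] assms(3) by blast
  then show ?thesis by (simp add: \<phi>_def)
qed

lemma smooth_on_continuous_on: "smooth_on S f \<Longrightarrow> continuous_on S f"
  by (meson continuous_at_imp_continuous_on differentiable_imp_continuous_within smooth_on_differentiable)

section \<open>Differential operators acting on powers of a vanishing function\<close>

text \<open>When \<open>f p = 0\<close>, a differential operator of order \<open>j \<le> m\<close> takes \<open>f\<^sup>m v\<close> to \<open>f\<close> to the power \<open>m - j\<close>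
times a smooth function, whose value at \<open>p\<close> is a factorial quotient times \<open>v p\<close> times the symbol at
\<open>df\<close>. Recording only \<open>m\<close> and the value \<open>c\<close> makes this a computation with numbers.\<close>
definition vanishing_form :: "(real^'n::finite) set \<Rightarrow> real^'n \<Rightarrow> (real^'n \<Rightarrow> real) \<Rightarrow> nat \<Rightarrow> real \<Rightarrow>
    (real^'n \<Rightarrow> real) \<Rightarrow> bool" where
  "vanishing_form S p f m c F \<longleftrightarrow> (\<exists>v. smooth_on S v \<and> v p = c \<and> (\<forall>x\<in>S. F x = f x ^ m * v x))"

lemma vanishing_formI:
  "smooth_on S v \<Longrightarrow> (\<And>x. x \<in> S \<Longrightarrow> F x = f x ^ m * v x) \<Longrightarrow> v p = c \<Longrightarrow> vanishing_form S p f m c F"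
  unfolding vanishing_form_def by blast

lemma vanishing_formE:
  assumes "vanishing_form S p f m c F"
  obtains v where "smooth_on S v" "\<And>x. x \<in> S \<Longrightarrow> F x = f x ^ m * v x" "v p = c"
  using assms unfolding vanishing_form_def by blast

context
  fixes S :: "(real^'n::finite) set" and p :: "real^'n" and f :: "real^'n \<Rightarrow> real"
  assumes S: "open S" and p: "p \<in> S" and f: "smooth_on S f" and fp: "f p = 0"
begin

lemma vanishing_form_add:
  assumes "vanishing_form S p f m c F" "vanishing_form S p f m d H"
  shows "vanishing_form S p f m (c + d) (\<lambda>x. F x + H x)"
proof -
  obtain v where v: "smooth_on S v" "\<And>x. x \<in> S \<Longrightarrow> F x = f x ^ m * v x" "v p = c"
    using assms(1) by (rule vanishing_formE) blast
  obtain w where w: "smooth_on S w" "\<And>x. x \<in> S \<Longrightarrow> H x = f x ^ m * w x" "w p = d"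
    using assms(2) by (rule vanishing_formE) blast
  show ?thesis
    by (rule vanishing_formI[OF smooth_on_add[OF S v(1) w(1)]]) (simp_all add: v w algebra_simps)
qed

lemma vanishing_form_mult:
  assumes "smooth_on S a" "vanishing_form S p f m c F"
  shows "vanishing_form S p f m (a p * c) (\<lambda>x. a x * F x)"
proof -
  obtain v where v: "smooth_on S v" "\<And>x. x \<in> S \<Longrightarrow> F x = f x ^ m * v x" "v p = c"
    using assms(2) by (rule vanishing_formE) blast
  show ?thesis
    by (rule vanishing_formI[OF smooth_on_mult[OF S assms(1) v(1)]]) (simp_all add: v)
qed

lemma vanishing_form_0: "vanishing_form S p f m 0 (\<lambda>x. 0)"
  by (rule vanishing_formI[of S "\<lambda>_. 0"]) auto

lemma vanishing_form_diff:
  assumes "vanishing_form S p f m c F" "vanishing_form S p f m d H"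
  shows "vanishing_form S p f m (c - d) (\<lambda>x. F x - H x)"
  using vanishing_form_add[OF assms(1) vanishing_form_mult[OF smooth_on_const assms(2), of "-1"]]
  by simp

lemma vanishing_form_sum:
  assumes "\<And>i. i \<in> I \<Longrightarrow> vanishing_form S p f m (c i) (F i)"
  shows "vanishing_form S p f m (\<Sum>i\<in>I. c i) (\<lambda>x. \<Sum>i\<in>I. F i x)"
  using assms
proof (induction I rule: infinite_finite_induct)
  case (insert i I)
  then show ?case
    using vanishing_form_add[of m "c i" "F i" "\<Sum>i\<in>I. c i" "\<lambda>x. \<Sum>i\<in>I. F i x"] by simp
qed (simp_all add: vanishing_form_0)

lemma vanishing_form_lower:
  assumes "vanishing_form S p f (Suc m) c F"
  shows "vanishing_form S p f m 0 F"
proof -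
  obtain v where v: "smooth_on S v" "\<And>x. x \<in> S \<Longrightarrow> F x = f x ^ Suc m * v x" "v p = c"
    using assms by (rule vanishing_formE) blast
  show ?thesis
    by (rule vanishing_formI[OF smooth_on_mult[OF S f v(1)]]) (simp_all add: v fp)
qed

lemma vanishing_form_pd:
  assumes "vanishing_form S p f (Suc m) c F"
  shows "vanishing_form S p f m (real (Suc m) * pd i f p * c) (pd i F)"
proof -
  obtain v where v: "smooth_on S v" "\<And>x. x \<in> S \<Longrightarrow> F x = f x ^ Suc m * v x" "v p = c"
    using assms by (rule vanishing_formE) blast
  let ?v = "\<lambda>x. real (Suc m) * pd i f x * v x + f x * pd i v x"
  have "smooth_on S ?v"
    by (intro smooth_on_add smooth_on_mult S f v(1) smooth_on_pd smooth_on_const)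
  moreover have "pd i F x = f x ^ m * ?v x" if x: "x \<in> S" for x
  proof -
    have df: "f differentiable (at x)" and dv: "v differentiable (at x)"
      using smooth_on_differentiable f v(1) x by blast+
    have "((\<lambda>x. f x ^ Suc m * v x) has_derivative
      (\<lambda>h. f x ^ Suc m * frechet_derivative v (at x) h
         + (real (Suc m) * frechet_derivative f (at x) h * f x ^ m) * v x)) (at x)"
      using has_derivative_mult[OF has_derivative_power[OF has_derivative_frechet[OF df], of "Suc m"]
          has_derivative_frechet[OF dv]] by (simp add: mult_ac)
    then have "pd i (\<lambda>x. f x ^ Suc m * v x) x = f x ^ m * ?v x"
      by (simp add: pd_eqI algebra_simps) (simp add: pd_def)
    moreover have "pd i F x = pd i (\<lambda>x. f x ^ Suc m * v x) x"
      using v(2) by (intro pd_cong[OF S x])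
    ultimately show ?thesis by simp
  qed
  ultimately show ?thesis
    by (rule vanishing_formI) (simp_all add: fp v(3))
qed

lemma vanishing_form_pds:
  assumes "vanishing_form S p f (length l + j) c F"
  shows "vanishing_form S p f j
     (fact (length l + j) / fact j * (\<Prod>i\<leftarrow>l. pd i f p) * c) (pds l F)"
  using assms
proof (induction l arbitrary: j)
  case (Cons i l)
  then have "vanishing_form S p f (Suc j)
     (fact (length l + Suc j) / fact (Suc j) * (\<Prod>i\<leftarrow>l. pd i f p) * c) (pds l F)"
    using Cons.IH[of "Suc j"] by simp
  from vanishing_form_pd[OF this, of i]
  have form: "vanishing_form S p f j (real (Suc j) * pd i f p *
     (fact (length l + Suc j) / fact (Suc j) * (\<Prod>i\<leftarrow>l. pd i f p) * c)) (pds (i # l) F)"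
    by simp
  (* Cancellation in the quotient of factorials, which are kept folded. *)
  have "s * x * (A / (s * B) * P * c) = A / B * (x * P) * c" if "s \<noteq> 0" for s x A B P :: real
    using that by simp
  then have eq: "real (Suc j) * pd i f p *
     (fact (length l + Suc j) / fact (Suc j) * (\<Prod>i\<leftarrow>l. pd i f p) * c)
     = fact (length (i # l) + j) / fact j * (\<Prod>i\<leftarrow>i # l. pd i f p) * c"
    by (simp only: fact_Suc of_nat_mult) simp
  show ?case using form by (simp only: eq)
qed simp

lemma vanishing_form_value: "vanishing_form S p f m c F \<Longrightarrow> F p = (if m = 0 then c else 0)"
  using p fp by (auto elim!: vanishing_formE)

text \<open>With \<open>m\<close> the order of the operator, all derivatives of lower order vanish at \<open>p\<close>, so only the symbol
survives. This is how symbols are detected below.\<close>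
lemma diff_op_at_vanishing_form:
  assumes "vanishing_form S p f m c F"
  shows "(\<Sum>l | length l \<le> m. a l p * pds l F p) = fact m * c * symb a m p (\<chi> i. pd i f p)"
proof -
  have fin: "finite {l :: 'n list. length l \<le> m}"
    using finite_lists_length_le[of "UNIV :: 'n set" m] by simp
  have "pds l F p = 0" if "length l < m" for l
    using vanishing_form_value[OF vanishing_form_pds[of l "m - length l" c F]] assms that by simp
  moreover have "pds l F p = fact m * (\<Prod>i\<leftarrow>l. pd i f p) * c" if "length l = m" for l
    using vanishing_form_value[OF vanishing_form_pds[of l 0 c F]] assms that by simp
  ultimately have "(\<Sum>l | length l \<le> m. a l p * pds l F p)
      = (\<Sum>l | length l \<le> m. if length l = m then a l p * (fact m * (\<Prod>i\<leftarrow>l. pd i f p) * c) else 0)"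
    by (intro sum.cong) auto
  also have "\<dots> = (\<Sum>l | length l = m. a l p * (fact m * (\<Prod>i\<leftarrow>l. pd i f p) * c))"
    by (subst sum.inter_filter[symmetric, OF fin]) (auto intro: sum.cong)
  finally show ?thesis by (simp add: symb_def sum_distrib_left mult_ac)
qed

lemma vanishing_form_laplacian:
  assumes G: "\<And>a b. smooth_on S (\<lambda>x. ginv G x $ a $ b)" "\<And>a b c. smooth_on S (chris G c a b)"
    and F: "vanishing_form S p f (Suc (Suc m)) c F"
  shows "vanishing_form S p f m (real (Suc (Suc m)) * real (Suc m) *
      (\<Sum>a\<in>UNIV. \<Sum>b\<in>UNIV. ginv G p $ a $ b * pd a f p * pd b f p) * c) (laplacian G F)"
proof -
  have "vanishing_form S p f m
     (\<Sum>a\<in>UNIV. \<Sum>b\<in>UNIV. ginv G p $ a $ b *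
        (real (Suc m) * pd a f p * (real (Suc (Suc m)) * pd b f p * c)
          - (\<Sum>d\<in>UNIV. chris G d a b p * 0))) (laplacian G F)"
    unfolding laplacian_def
    by (intro vanishing_form_sum vanishing_form_mult vanishing_form_diff vanishing_form_pd G F
        vanishing_form_lower[OF vanishing_form_pd[OF F]])
  then show ?thesis
    by (simp add: sum_distrib_left sum_distrib_right mult_ac)
qed

lemma vanishing_form_laplacian_power:
  assumes G: "\<And>a b. smooth_on S (\<lambda>x. ginv G x $ a $ b)" "\<And>a b c. smooth_on S (chris G c a b)"
    and F: "vanishing_form S p f (2 * k + j) c F"
  shows "vanishing_form S p f j (fact (2 * k + j) / fact j *
      (\<Sum>a\<in>UNIV. \<Sum>b\<in>UNIV. ginv G p $ a $ b * pd a f p * pd b f p) ^ k * c) ((laplacian G ^^ k) F)"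
  using F
proof (induction k arbitrary: j)
  case (Suc k)
  from Suc.IH[of "Suc (Suc j)"] Suc.prems
  have "vanishing_form S p f (Suc (Suc j)) (fact (2 * k + Suc (Suc j)) / fact (Suc (Suc j)) *
      (\<Sum>a\<in>UNIV. \<Sum>b\<in>UNIV. ginv G p $ a $ b * pd a f p * pd b f p) ^ k * c) ((laplacian G ^^ k) F)"
    by simp
  from vanishing_form_laplacian[OF G this]
  have form: "vanishing_form S p f j (real (Suc (Suc j)) * real (Suc j) *
      (\<Sum>a\<in>UNIV. \<Sum>b\<in>UNIV. ginv G p $ a $ b * pd a f p * pd b f p) *
      (fact (2 * k + Suc (Suc j)) / fact (Suc (Suc j)) *
      (\<Sum>a\<in>UNIV. \<Sum>b\<in>UNIV. ginv G p $ a $ b * pd a f p * pd b f p) ^ k * c))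
      ((laplacian G ^^ Suc k) F)"
    by simp
  (* Cancellation in the quotient of factorials, which are kept folded. *)
  have "s * t * Q * (A / (s * (t * B)) * P * c) = A / B * (Q * P) * c"
    if "s \<noteq> 0" "t \<noteq> 0" for s t Q A B P :: real
    using that by simp
  then have eq: "real (Suc (Suc j)) * real (Suc j) * Q *
      (fact (2 * k + Suc (Suc j)) / fact (Suc (Suc j)) * Q ^ k * c)
      = fact (2 * Suc k + j) / fact j * Q ^ Suc k * c" for Q
    by (simp only: fact_Suc of_nat_mult power_Suc) simp
  show ?case using form by (simp only: eq)
qed simp

end

section \<open>Smoothness of the inverse metric and the Christoffel symbols\<close>

lemma invertible_matrix_inv:
  fixes A :: "real^'n::finite^'n"
  assumes "invertible A"
  shows "A ** matrix_inv A = mat 1" "matrix_inv A ** A = mat 1"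
  using someI_ex[OF assms[unfolded invertible_def]] by (simp_all add: matrix_inv_def)

lemma matrix_inv_eqI:
  fixes A B :: "real^'n::finite^'n"
  assumes "A ** B = mat 1" "B ** A = mat 1"
  shows "matrix_inv A = B"
proof -
  have "invertible A" using assms invertible_def by blast
  then have "matrix_inv A ** A = mat 1" by (rule invertible_matrix_inv)
  then have "matrix_inv A ** (A ** B) = B" by (simp add: matrix_mul_assoc)
  then show ?thesis using assms by simp
qed

lemma smooth_on_det:
  assumes "open S" "\<And>i j. smooth_on S (\<lambda>x. G x $ i $ j)"
  shows "smooth_on S (\<lambda>x. det (G x))"
  unfolding det_def
  by (intro smooth_on_sum smooth_on_mult smooth_on_prod assms smooth_on_const)

text \<open>By Cramer's rule, an entry of the inverse is a quotient of determinants.\<close>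
lemma smooth_on_matrix_inv:
  fixes G :: "real^'n::finite \<Rightarrow> real^'m::finite^'m"
  assumes S: "open S" and G: "\<And>i j. smooth_on S (\<lambda>x. G x $ i $ j)" "\<And>x. x \<in> S \<Longrightarrow> det (G x) \<noteq> 0"
  shows "smooth_on S (\<lambda>x. matrix_inv (G x) $ a $ b)"
proof -
  define M :: "real^'n \<Rightarrow> real^'m^'m" where
    "M x = (\<chi> i j. if j = a then axis b 1 $ i else G x $ i $ j)" for x
  have "smooth_on S (\<lambda>x. M x $ i $ j)" for i j
    unfolding M_def using G(1) by (cases "j = a") auto
  then have "smooth_on S (\<lambda>x. det (M x) * inverse (det (G x)))"
    using G by (intro smooth_on_mult smooth_on_inverse smooth_on_det S) auto
  moreover have "det (M x) * inverse (det (G x)) = matrix_inv (G x) $ a $ b" if "x \<in> S" for x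
  proof -
    have d: "det (G x) \<noteq> 0" using G that by blast
    then have "G x ** matrix_inv (G x) = mat 1"
      using invertible_matrix_inv(1) invertible_det_nz by blast
    then have "G x *v (matrix_inv (G x) *v axis b 1) = axis b 1"
      by (simp add: matrix_vector_mul_assoc)
    then have "(matrix_inv (G x) *v axis b 1) $ a = det (M x) / det (G x)"
      using cramer[OF d] unfolding M_def by simp
    then show ?thesis
      by (simp add: matrix_vector_mul_component inner_axis divide_inverse)
  qed
  ultimately show ?thesis by (rule smooth_on_cong[OF S, rotated])
qed

lemma smooth_on_chris:
  assumes S: "open S" and G: "\<And>i j. smooth_on S (\<lambda>x. G x $ i $ j)" "\<And>x. x \<in> S \<Longrightarrow> det (G x) \<noteq> 0"
  shows "smooth_on S (chris G c a b)"
  unfolding chris_def ginv_def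
  by (intro smooth_on_mult smooth_on_sum smooth_on_add smooth_on_diff smooth_on_pd smooth_on_matrix_inv
      smooth_on_const S G) auto

section \<open>A smooth cutoff function\<close>

definition exp_cutoff :: "real \<Rightarrow> real" where
  "exp_cutoff y = (if y \<le> 0 then 0 else exp (- inverse y))"

text \<open>The \<open>k\<close>-th derivative of \<open>exp (- 1/y)\<close>, for positive \<open>y\<close>, is \<open>cutoff_poly k\<close> at \<open>1/y\<close> times
\<open>exp (- 1/y)\<close>.\<close>
primrec cutoff_poly :: "nat \<Rightarrow> real poly" where
  "cutoff_poly 0 = 1"
| "cutoff_poly (Suc k) = [:0, 0, 1:] * (cutoff_poly k - pderiv (cutoff_poly k))"

lemma poly_over_exp_tendsto_0: "((\<lambda>s. poly q s * exp (- s)) \<longlongrightarrow> (0::real)) at_top"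
proof -
  have "((\<lambda>s. \<Sum>i\<le>degree q. coeff q i * (s ^ i / exp s)) \<longlongrightarrow> (\<Sum>i\<le>degree q. coeff q i * 0)) at_top"
    by (intro tendsto_sum tendsto_mult tendsto_const tendsto_power_div_exp_0)
  then show ?thesis
    by (simp add: poly_altdef sum_distrib_left exp_minus divide_inverse mult_ac)
qed

text \<open>At \<open>y = 0\<close> the difference quotient from the right is, in terms of \<open>s = 1/y\<close>, the polynomial \<open>s q\<close>
times \<open>exp (- s)\<close>, and tends to \<open>0\<close>. Allowing any polynomial \<open>q\<close> makes this one statement cover all
the derivatives of the cutoff function.\<close>
lemma exp_cutoff_derivatives:
  fixes q :: "real poly"
  defines "\<phi> \<equiv> \<lambda>q y. if y \<le> 0 then 0 else poly q (inverse y) * exp (- inverse y)"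
  shows "(\<phi> q has_real_derivative \<phi> ([:0, 0, 1:] * (q - pderiv q)) y) (at y)"
proof -
  consider "y < 0" | "y = 0" | "y > 0" by linarith
  then show ?thesis
  proof cases
    case 1
    have "((\<lambda>_. 0) has_real_derivative 0) (at y)" by simp
    then have "(\<phi> q has_real_derivative 0) (at y)"
      by (rule has_field_derivative_transform_within_open[of _ _ _ "{..<0}"]) (use 1 in \<open>auto simp: \<phi>_def\<close>)
    then show ?thesis using 1 by (simp add: \<phi>_def)
  next
    case 2
    have "((\<lambda>h. \<phi> q h / h) \<longlongrightarrow> 0) (at_right 0)"
      unfolding filterlim_at_right_to_top
    proof (rule Lim_transform_eventually)
      show "((\<lambda>s. poly ([:0, 1:] * q) s * exp (- s)) \<longlongrightarrow> 0) at_top"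
        by (rule poly_over_exp_tendsto_0)
      show "\<forall>\<^sub>F s in at_top. poly ([:0, 1:] * q) s * exp (- s) = \<phi> q (inverse s) / inverse s"
        using eventually_gt_at_top[of 0] by eventually_elim (auto simp: \<phi>_def field_simps)
    qed
    moreover have "((\<lambda>h. \<phi> q h / h) \<longlongrightarrow> 0) (at_left 0)"
    proof (rule Lim_transform_eventually)
      show "\<forall>\<^sub>F h in at_left 0. 0 = \<phi> q h / h"
        unfolding eventually_at_left_field by (rule exI[of _ "-1"]) (auto simp: \<phi>_def)
    qed auto
    ultimately have "((\<lambda>h. \<phi> q h / h) \<longlongrightarrow> 0) (at 0)"
      by (rule filterlim_split_at_real[rotated])
    moreover have zero: "\<phi> r 0 = 0" for r by (simp add: \<phi>_def)
    ultimately have "(\<phi> q has_real_derivative 0) (at 0)"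
      unfolding DERIV_def by simp
    then show ?thesis using 2 zero by simp
  next
    case 3
    have "((\<lambda>y. poly q (inverse y) * exp (- inverse y)) has_real_derivative
        poly q (inverse y) * (exp (- inverse y) * inverse y ^ 2)
        + poly (pderiv q) (inverse y) * (- (inverse y ^ 2)) * exp (- inverse y)) (at y)"
      using 3 by (auto intro!: derivative_eq_intros DERIV_chain'[OF _ poly_DERIV]
          simp: power2_eq_square field_simps)
    then have "(\<phi> q has_real_derivative
        poly q (inverse y) * (exp (- inverse y) * inverse y ^ 2)
        + poly (pderiv q) (inverse y) * (- (inverse y ^ 2)) * exp (- inverse y)) (at y)"
      by (rule has_field_derivative_transform_within_open[of _ _ _ "{0<..}"]) (use 3 in \<open>auto simp: \<phi>_def\<close>)
    then show ?thesis using 3 by (simp add: \<phi>_def algebra_simps power2_eq_square)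
  qed
qed

lemma smooth_on_exp_cutoff:
  assumes "open S" "smooth_on S f"
  shows "smooth_on S (\<lambda>x. exp_cutoff (f x))"
proof -
  define \<phi> where "\<phi> k y = (if y \<le> 0 then 0 else poly (cutoff_poly k) (inverse y) * exp (- inverse y))"
    for k and y :: real
  have "(\<phi> k has_real_derivative \<phi> (Suc k) y) (at y)" for k y
    unfolding \<phi>_def[abs_def] cutoff_poly.simps by (rule exp_cutoff_derivatives)
  then have "smooth_on S (\<lambda>x. \<phi> 0 (f x))"
    using smooth_on_real_comp[OF assms, of \<phi>] by blast
  then show ?thesis by (simp add: \<phi>_def exp_cutoff_def cong: if_cong)
qed

section \<open>Densities with prescribed local behaviour\<close>

lemma chart_properties:
  assumes "smooth_atlas A" "ch \<in> A"
  shows "continuous_on (snd ch ` fst ch) (inv_into (fst ch) (snd ch))"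
    and "continuous_on (fst ch) (snd ch)" and "inj_on (snd ch) (fst ch)"
    and "open (fst ch)" "open (snd ch ` fst ch)"
proof -
  have *: "homeomorphism (fst ch) (snd ch ` fst ch) (snd ch) (inv_into (fst ch) (snd ch))"
    and o: "open (fst ch)" "open (snd ch ` fst ch)"
    using assms unfolding smooth_atlas_def by blast+
  show "continuous_on (snd ch ` fst ch) (inv_into (fst ch) (snd ch))" "continuous_on (fst ch) (snd ch)"
    using * unfolding homeomorphism_def by blast+
  show "inj_on (snd ch) (fst ch)"
    using * unfolding homeomorphism_def by (metis inj_onI)
  show "open (fst ch)" "open (snd ch ` fst ch)" by (rule o)+
qed

lemma open_chart_image:
  assumes "smooth_atlas A" "ch \<in> A" "open U"
  shows "open (snd ch ` (fst ch \<inter> U))"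
proof -
  note c = chart_properties[OF assms(1,2)]
  have "snd ch ` (fst ch \<inter> U) = snd ch ` fst ch \<inter> inv_into (fst ch) (snd ch) -` U"
    using c(3) by (auto simp: inv_into_f_f)
  then show ?thesis
    using continuous_open_preimage[OF c(1) c(5) assms(3)] by simp
qed

lemma loc_chart:
  assumes "smooth_atlas A" "ch \<in> A" "q \<in> fst ch"
  shows "loc ch u (snd ch q) = u q"
  using chart_properties(3)[OF assms(1,2)] assms(3) by (simp add: loc_def)

lemma msmooth_on_const: "msmooth_on A U (\<lambda>_. c)"
  unfolding msmooth_on_def loc_def by simp

lemma
  assumes "smooth_atlas A" "open U" "msmooth_on A U f"
  shows msmooth_on_exp: "msmooth_on A U (\<lambda>q. exp (f q))"
    and msmooth_on_add: "msmooth_on A U h \<Longrightarrow> msmooth_on A U (\<lambda>q. f q + h q)"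
    and msmooth_on_mult: "msmooth_on A U h \<Longrightarrow> msmooth_on A U (\<lambda>q. f q * h q)"
  using assms open_chart_image[OF assms(1) _ assms(2)] unfolding msmooth_on_def loc_def
  by (auto intro!: smooth_on_exp smooth_on_add smooth_on_mult)

lemma conformal_class_posdef:
  assumes "conformal_class A c" "g \<in> c" "ch \<in> A" "p \<in> fst ch" "v \<noteq> 0"
  shows "v \<bullet> (g ch p *v v) > 0"
proof -
  obtain g0 \<Upsilon> where g0: "riemannian_metric A g0" and g: "g = rescale \<Upsilon> g0"
    using assms(1,2) unfolding conformal_class_def by blast
  have "v \<bullet> (g0 ch p *v v) > 0"
    using g0 assms(3-5) unfolding riemannian_metric_def by blast
  then show ?thesis
    by (simp add: g rescale_def scaleR_matrix_vector_assoc[symmetric])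
qed

text \<open>Positive definiteness makes the scale factor between two metrics of the class unique; this is what
allows a density to be defined by its value in a single scale.\<close>
lemma rescale_inject:
  assumes "smooth_atlas A" "riemannian_metric A g" "rescale \<Upsilon> g = rescale \<Upsilon>' g"
  shows "\<Upsilon> = \<Upsilon>'"
proof
  fix p
  obtain ch where ch: "ch \<in> A" "p \<in> fst ch"
    using assms(1) unfolding smooth_atlas_def by blast
  define v :: "real^'b" where "v = axis undefined 1"
  have "v \<noteq> 0" by (simp add: v_def axis_eq_0_iff)
  then have pos: "v \<bullet> (g ch p *v v) > 0"
    using assms(2) ch unfolding riemannian_metric_def by blast
  have "exp (2 * \<Upsilon> p) *\<^sub>R g ch p = exp (2 * \<Upsilon>' p) *\<^sub>R g ch p"
    using assms(3) unfolding rescale_def by meson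
  then have "v \<bullet> ((exp (2 * \<Upsilon> p) *\<^sub>R g ch p) *v v) = v \<bullet> ((exp (2 * \<Upsilon>' p) *\<^sub>R g ch p) *v v)"
    by (simp only:)
  then show "\<Upsilon> p = \<Upsilon>' p"
    using pos by (simp add: scaleR_matrix_vector_assoc[symmetric])
qed

lemma density_of_function:
  assumes A: "smooth_atlas (atlas X)" and c: "conformal_class (atlas X) (cclass X)"
    and g: "g \<in> cclass X" and \<phi>: "msmooth_on (atlas X) UNIV \<phi>"
  obtains V where "V \<in> densities X w" "V g = \<phi>"
proof -
  obtain g0 where g0: "riemannian_metric (atlas X) g0"
    and cl: "cclass X = {rescale \<Upsilon> g0 |\<Upsilon>. msmooth_on (atlas X) UNIV \<Upsilon>}"
    using c unfolding conformal_class_def by blast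
  define factor where "factor h = (THE \<Upsilon>. h = rescale \<Upsilon> g0)" for h
  have factor: "factor (rescale \<Upsilon> g0) = \<Upsilon>" for \<Upsilon>
    unfolding factor_def using rescale_inject[OF A g0] by blast
  have smooth: "msmooth_on (atlas X) UNIV (factor h)" if "h \<in> cclass X" for h
    using that factor cl by auto
  have comp: "factor (rescale \<Upsilon> h) p = \<Upsilon> p + factor h p" if "h \<in> cclass X" for h \<Upsilon> p
  proof -
    obtain \<Upsilon>' where h: "h = rescale \<Upsilon>' g0" using \<open>h \<in> cclass X\<close> cl by blast
    have "rescale \<Upsilon> h = rescale (\<lambda>q. \<Upsilon> q + \<Upsilon>' q) g0"
      unfolding h rescale_def by (simp add: exp_add distrib_left)
    then show ?thesis by (simp add: factor h)
  qed
  (* The exponent is w times the logarithmic scale factor from g to h. *)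
  define V where "V h p = exp (w * factor h p + (- w) * factor g p) * \<phi> p" for h p
  have "msmooth_on (atlas X) UNIV (V h)" if "h \<in> cclass X" for h
    unfolding V_def
    by (intro msmooth_on_mult msmooth_on_exp msmooth_on_add msmooth_on_const A open_UNIV smooth that g \<phi>)
  moreover have "V (rescale \<Upsilon> h) p = exp (w * \<Upsilon> p) * V h p" if "h \<in> cclass X" for h \<Upsilon> p
    using comp[OF that] by (simp add: V_def distrib_left flip: exp_add)
  ultimately have "V \<in> densities X w"
    unfolding densities_def by blast
  moreover have "V g = \<phi>" by (simp add: V_def fun_eq_iff)
  ultimately show ?thesis by (rule that)
qed

text \<open>A function on a chart becomes a density on the whole manifold after multiplication with a cutoff
\<open>\<beta>\<close> supported in a small closed ball: the preimage of the ball is compact, hence closed in a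
Hausdorff space, and extension by zero is smooth. A positive value of \<open>\<beta>\<close> at the point is what is needed to read off
symbols there.\<close>
lemma test_density:
  fixes X :: "('m::t2_space, 'n::finite) cmfd"
  assumes A: "smooth_atlas (atlas X)" and c: "conformal_class (atlas X) (cclass X)"
    and g: "g \<in> cclass X" and ch: "ch \<in> atlas X" and p: "p \<in> fst ch"
    and F: "smooth_on (snd ch ` fst ch) F"
  obtains V \<beta> where "V \<in> densities X w" "smooth_on (snd ch ` fst ch) \<beta>" "\<beta> (snd ch p) > 0"
    "\<And>x. x \<in> snd ch ` fst ch \<Longrightarrow> loc ch (V g) x = \<beta> x * F x"
proof -
  let ?D = "snd ch ` fst ch" and ?x = "snd ch p" and ?inv = "inv_into (fst ch) (snd ch)"
  note chart = chart_properties[OF A ch]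
  obtain r where r: "r > 0" "cball ?x r \<subseteq> ?D"
    using open_contains_cball chart(5) p by blast
  define \<beta> where "\<beta> y = exp_cutoff (r\<^sup>2 - (\<Sum>i\<in>UNIV. (y $ i - ?x $ i)\<^sup>2))" for y
  have \<beta>: "smooth_on S \<beta>" if "open S" for S
    unfolding \<beta>_def[abs_def]
    by (intro smooth_on_exp_cutoff smooth_on_diff smooth_on_sum smooth_on_power smooth_on_const
        smooth_on_coordinate that)
  have \<beta>0: "\<beta> y = 0" if "y \<notin> cball ?x r" for y
  proof -
    have "(dist ?x y)\<^sup>2 = (\<Sum>i\<in>UNIV. (y $ i - ?x $ i)\<^sup>2)"
      unfolding dist_norm power2_norm_eq_inner inner_vec_def
      by (simp add: power2_eq_square algebra_simps)
    moreover have "r\<^sup>2 \<le> (dist ?x y)\<^sup>2"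
      using that r(1) by (intro power_mono) auto
    ultimately show ?thesis by (simp add: \<beta>_def exp_cutoff_def)
  qed
  define \<phi> where "\<phi> q = (if q \<in> fst ch then \<beta> (snd ch q) * F (snd ch q) else 0)" for q
  define K where "K = ?inv ` cball ?x r"
  have "compact K"
    unfolding K_def
    by (rule compact_continuous_image[OF continuous_on_subset[OF chart(1) r(2)] compact_cball])
  then have K: "open (- K)" using compact_imp_closed by blast
  have K_sub: "K \<subseteq> fst ch"
    unfolding K_def using r(2) by (auto intro: inv_into_into)
  have outside: "\<phi> q = 0" if "q \<notin> K" for q
  proof (cases "q \<in> fst ch")
    case True
    then have "snd ch q \<notin> cball ?x r"
      using that chart(3) unfolding K_def by (metis image_eqI inv_into_f_f)
    then show ?thesis by (simp add: \<phi>_def \<beta>0)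
  qed (simp add: \<phi>_def)
  have "smooth_on (snd ch' ` fst ch') (loc ch' \<phi>)" if ch': "ch' \<in> atlas X" for ch'
  proof -
    let ?E = "snd ch' ` (fst ch' \<inter> fst ch)" and ?E' = "snd ch' ` (fst ch' \<inter> - K)"
    have E: "open ?E" "open ?E'"
      using open_chart_image[OF A ch'] K chart(4) by blast+
    define \<tau> where "\<tau> y = snd ch (inv_into (fst ch') (snd ch') y)" for y
    have "smooth_on ?E (\<lambda>y. \<beta> (\<tau> y) * F (\<tau> y))"
    proof (rule smooth_on_compose[OF E(1), of \<tau> ?D "\<lambda>x. \<beta> x * F x"])
      show "smooth_on ?E (\<lambda>y. \<tau> y $ i)" for i
        using A ch ch' unfolding smooth_atlas_def \<tau>_def loc_def by blast
      show "\<tau> ` ?E \<subseteq> ?D"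
        using chart_properties(3)[OF A ch'] by (auto simp: \<tau>_def)
      show "smooth_on ?D (\<lambda>x. \<beta> x * F x)"
        by (intro smooth_on_mult chart(5) F \<beta>)
    qed
    then have "smooth_on ?E (loc ch' \<phi>)"
      by (rule smooth_on_cong[OF E(1), rotated])
        (use loc_chart[OF A ch', of _ \<phi>] chart_properties(3)[OF A ch'] in
          \<open>auto simp: \<tau>_def \<phi>_def\<close>)
    moreover have "smooth_on ?E' (loc ch' \<phi>)"
      by (rule smooth_on_cong[OF E(2) _ smooth_on_const[of ?E' 0]])
        (use loc_chart[OF A ch', of _ \<phi>] outside in auto)
    ultimately have "smooth_on (?E \<union> ?E') (loc ch' \<phi>)" by (rule smooth_on_Un)
    moreover have "?E \<union> ?E' = snd ch' ` fst ch'" using K_sub by blast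
    ultimately show ?thesis by simp
  qed
  then have "msmooth_on (atlas X) UNIV \<phi>" unfolding msmooth_on_def by simp
  then obtain V where V: "V \<in> densities X w" "V g = \<phi>"
    using density_of_function[OF A c g] by blast
  show ?thesis
  proof (rule that[OF V(1) \<beta>[OF chart(5)]])
    show "\<beta> ?x > 0" using r(1) by (simp add: \<beta>_def exp_cutoff_def)
    show "loc ch (V g) x = \<beta> x * F x" if "x \<in> ?D" for x
      using that loc_chart[OF A ch, of _ \<phi>] V(2) by (auto simp: \<phi>_def)
  qed
qed

section \<open>The symbol of the GJMS operators\<close>

lemma sum_UNIV_ext: "(\<Sum>I\<in>UNIV. f I) = f Top + f Bot + (\<Sum>i\<in>UNIV. f (Mid i))"
  for f :: "'n::finite ext \<Rightarrow> 'a::comm_monoid_add"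
proof -
  have U: "(UNIV :: 'n ext set) = insert Top (insert Bot (range Mid))"
    by (auto, metis ext.exhaust rangeI)
  have "sum f (range Mid) = (\<Sum>i\<in>UNIV. f (Mid i))"
    by (rule sum.reindex_cong[of Mid]) (auto simp: inj_on_def)
  moreover have "sum f (insert Top (insert Bot (range Mid))) = f Top + (f Bot + sum f (range Mid))"
    by (subst sum.insert, simp, blast)+ simp
  ultimately show ?thesis by (simp add: U add.assoc)
qed

text \<open>The ambient metric at \<open>t = 1\<close>, \<open>\<rho> = 0\<close>, where \<open>M\<close> is the metric on the base. The block of \<open>Top\<close> and
\<open>Bot\<close> is its own inverse, so the inverse of the ambient metric has the same shape.\<close>
definition split_matrix :: "real^'n^'n \<Rightarrow> real^('n::finite ext)^('n ext)" where
  "split_matrix M = (\<chi> I J. case I of Top \<Rightarrow> if J = Bot then 1 else 0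
     | Bot \<Rightarrow> if J = Top then 1 else 0
     | Mid i \<Rightarrow> (case J of Mid j \<Rightarrow> M $ i $ j | _ \<Rightarrow> 0))"

lemma split_matrix_simps [simp]:
  "split_matrix M $ Top $ J = (if J = Bot then 1 else 0)"
  "split_matrix M $ Bot $ J = (if J = Top then 1 else 0)"
  "split_matrix M $ Mid i $ Mid j = M $ i $ j"
  "split_matrix M $ Mid i $ Top = 0"
  "split_matrix M $ Mid i $ Bot = 0"
  by (simp_all add: split_matrix_def)

lemma split_matrix_inverse:
  assumes "A ** B = mat 1"
  shows "split_matrix A ** split_matrix B = mat 1"
proof -
  have AB: "(\<Sum>l\<in>UNIV. A $ i $ l * B $ l $ j) = (if i = j then 1 else 0)" for i j
    using arg_cong[OF assms, of "\<lambda>M. M $ i $ j"] by (simp add: matrix_matrix_mult_def mat_def)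
  have "(split_matrix A ** split_matrix B) $ I $ J = mat 1 $ I $ J" for I J
    by (cases I; cases J) (simp_all add: matrix_matrix_mult_def sum_UNIV_ext mat_def AB)
  then show ?thesis by (simp add: vec_eq_iff)
qed

lemma amb_metric_at_cone:
  "amb_metric \<gamma> (amb_pt 1 x 0) = split_matrix (\<gamma> 0 x)"
proof -
  have "xpart (amb_pt 1 x 0) = x" by (simp add: xpart_def amb_pt_def vec_eq_iff)
  then have "amb_metric \<gamma> (amb_pt 1 x 0) $ I $ J = split_matrix (\<gamma> 0 x) $ I $ J" for I J
    by (cases I; cases J) (simp_all add: amb_metric_def amb_pt_def)
  then show ?thesis by (simp add: vec_eq_iff)
qed

lemma posdef_invertible:
  fixes M :: "real^'n::finite^'n"
  assumes "\<And>v. v \<noteq> 0 \<Longrightarrow> v \<bullet> (M *v v) > 0"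
  shows "invertible M"
proof -
  have "x = 0" if "M *v x = 0" for x
    using assms[of x] that by (cases "x = 0") auto
  then have "\<exists>B. B ** M = mat 1" by (simp add: matrix_left_invertible_ker)
  then show ?thesis by (simp add: invertible_left_inverse)
qed

lemma posdef_matrix_inv:
  fixes M :: "real^'n::finite^'n"
  assumes "\<And>v. v \<noteq> 0 \<Longrightarrow> v \<bullet> (M *v v) > 0" and "\<xi> \<noteq> 0"
  shows "\<xi> \<bullet> (matrix_inv M *v \<xi>) > 0"
proof -
  have inv: "M ** matrix_inv M = mat 1"
    using posdef_invertible[of M] assms(1) invertible_matrix_inv(1) by blast
  let ?v = "matrix_inv M *v \<xi>"
  have M: "M *v ?v = \<xi>" by (simp add: matrix_vector_mul_assoc inv)
  then have "?v \<noteq> 0" using assms(2) by auto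
  then show ?thesis using assms(1)[of ?v] by (simp add: M inner_commute)
qed

lemma quadratic_form_sum:
  fixes M :: "real^'n::finite^'n"
  shows "\<xi> \<bullet> (M *v \<xi>) = (\<Sum>a\<in>UNIV. \<Sum>b\<in>UNIV. M $ a $ b * \<xi> $ a * \<xi> $ b)"
  by (simp add: inner_vec_def matrix_vector_mult_def sum_distrib_left mult_ac)

lemma pd_affine: "pd i (\<lambda>x. (\<xi>::real^'n::finite) \<bullet> (x - x0)) x = \<xi> $ i"
proof -
  have "((\<lambda>x. \<xi> \<bullet> (x - x0)) has_derivative (\<lambda>h. \<xi> \<bullet> h)) (at x)"
    by (auto intro!: derivative_eq_intros)
  then show ?thesis by (simp add: pd_eqI inner_axis)
qed

lemma smooth_on_affine:
  assumes "open S"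
  shows "smooth_on S (\<lambda>x. (\<xi>::real^'n::finite) \<bullet> (x - x0))"
  unfolding inner_vec_def
  by (auto intro!: smooth_on_sum smooth_on_mult smooth_on_diff assms)

lemma bounded_linear_xpart: "bounded_linear (xpart :: real^('n::finite ext) \<Rightarrow> real^'n)"
  unfolding linear_conv_bounded_linear[symmetric]
  by (rule linearI) (simp_all add: xpart_def vec_eq_iff)

lemma pd_affine_xpart:
  "pd I (\<lambda>z. (\<xi>::real^'n::finite) \<bullet> (xpart z - x0)) z = (case I of Mid i \<Rightarrow> \<xi> $ i | _ \<Rightarrow> 0)"
proof -
  have "((\<lambda>z. \<xi> \<bullet> (xpart z - x0)) has_derivative (\<lambda>h. \<xi> \<bullet> xpart h)) (at z)"
    by (auto intro!: derivative_eq_intros bounded_linear_imp_has_derivative[OF bounded_linear_xpart])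
  then have "pd I (\<lambda>z. \<xi> \<bullet> (xpart z - x0)) z = \<xi> \<bullet> xpart (axis I 1)"
    by (rule pd_eqI)
  moreover have "xpart (axis I 1) = (case I of Mid i \<Rightarrow> axis i 1 | _ \<Rightarrow> 0)"
    by (cases I) (auto simp: xpart_def axis_def vec_eq_iff)
  ultimately show ?thesis by (cases I) (simp_all add: inner_axis)
qed

lemma smooth_on_xpart_compose:
  fixes F :: "real^'n::finite \<Rightarrow> real"
  assumes "open S" "smooth_on N F" "\<And>z. z \<in> S \<Longrightarrow> xpart z \<in> N"
  shows "smooth_on S (\<lambda>z. F (xpart z))"
  by (rule smooth_on_compose[OF assms(1) _ _ assms(2)]) (use assms(3) in \<open>auto simp: xpart_def\<close>)

text \<open>Near the point \<open>t = 1\<close>, \<open>\<rho> = 0\<close> over \<open>x\<close> the ambient metric is invertible, hence the ambient Laplacian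
has smooth coefficients and acts on \<open>f\<^sup>2\<^sup>k\<close> through its symbol, with \<open>f\<close> the pullback of
\<open>\<xi> \<bullet> (y - x)\<close>. The homogeneity factor \<open>t\<^sup>w\<close> is \<open>1\<close> at the point.\<close>
lemma ambient_laplacian_power:
  fixes G :: "'n::finite gmat" and \<beta> F :: "real^'n \<Rightarrow> real"
  assumes amb: "ambient_metric fl Q N G \<gamma>" and N: "open N" "x \<in> N"
    and inv: "invertible (G x)" and \<beta>: "smooth_on N \<beta>"
    and F: "\<And>y. y \<in> N \<Longrightarrow> F y = \<beta> y * (\<xi> \<bullet> (y - x)) ^ (2 * k)"
  shows "(laplacian (amb_metric \<gamma>) ^^ k) (\<lambda>z. (z $ Top) powr w * F (xpart z)) (amb_pt 1 x 0)
    = fact (2 * k) * (\<xi> \<bullet> (ginv G x *v \<xi>)) ^ k * \<beta> x"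
proof -
  note amb = amb[unfolded ambient_metric_def]
  obtain \<Omega> where \<Omega>: "open \<Omega>" "\<forall>t>0. \<forall>x\<in>N. amb_pt t x 0 \<in> \<Omega>"
    "\<And>I J. smooth_on \<Omega> (\<lambda>z. amb_metric \<gamma> z $ I $ J)"
    using conjunct1[OF amb] by (elim exE conjE) (rule that, assumption, assumption, blast)
  have \<gamma>0: "\<gamma> 0 x = G x"
    using conjunct1[OF conjunct2[OF amb]] N(2) by blast
  let ?g = "amb_metric \<gamma>" and ?z = "amb_pt 1 x 0"
  have xz: "xpart ?z = x" by (simp add: xpart_def amb_pt_def vec_eq_iff)
  have "G x ** ginv G x = mat 1" "ginv G x ** G x = mat 1"
    using invertible_matrix_inv[OF inv] by (simp_all add: ginv_def)
  then have prod: "?g ?z ** split_matrix (ginv G x) = mat 1" "split_matrix (ginv G x) ** ?g ?z = mat 1"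
    by (simp_all add: amb_metric_at_cone \<gamma>0 split_matrix_inverse)
  then have ginv_z: "ginv ?g ?z = split_matrix (ginv G x)"
    unfolding ginv_def[of ?g] by (rule matrix_inv_eqI)
  have det_z: "det (?g ?z) \<noteq> 0"
    using prod invertible_det_nz[of "?g ?z"] unfolding invertible_def by blast
  define \<Omega>' where "\<Omega>' = \<Omega> \<inter> {z. z $ Top > 0} \<inter> xpart -` N"
  have "open {z :: real^('n ext). z $ Top > 0}"
    by (intro open_Collect_less continuous_intros)
  moreover have "open (xpart -` N :: (real^('n ext)) set)"
    using N(1) linear_continuous_on[OF bounded_linear_xpart, of UNIV]
    by (auto simp: continuous_on_open_vimage)
  ultimately have \<Omega>': "open \<Omega>'"
    unfolding \<Omega>'_def using \<Omega>(1) by (intro open_Int)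
  define S where "S = \<Omega>' \<inter> (\<lambda>z. det (?g z)) -` (- {0})"
  have gs: "smooth_on \<Omega>' (\<lambda>z. ?g z $ I $ J)" for I J
    by (rule smooth_on_subset[OF \<Omega>(3)]) (auto simp: \<Omega>'_def)
  have "continuous_on \<Omega>' (\<lambda>z. det (?g z))"
    by (rule smooth_on_continuous_on[OF smooth_on_det[OF \<Omega>' gs]])
  then have S: "open S"
    unfolding S_def by (rule continuous_open_preimage[OF _ \<Omega>']) auto
  have z: "?z \<in> S"
    using \<Omega>(2) N(2) det_z xz by (simp add: S_def \<Omega>'_def) (simp add: amb_pt_def)
  have gS: "smooth_on S (\<lambda>z. ?g z $ I $ J)" for I J
    by (rule smooth_on_subset[OF gs]) (auto simp: S_def)
  have dS: "det (?g z) \<noteq> 0" if "z \<in> S" for z using that by (simp add: S_def)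
  have NS: "xpart z \<in> N" and pS: "z $ Top > 0" if "z \<in> S" for z
    using that by (simp_all add: S_def \<Omega>'_def)
  let ?f = "\<lambda>z. \<xi> \<bullet> (xpart z - x)"
  have f: "smooth_on S ?f"
    by (rule smooth_on_xpart_compose[OF S smooth_on_affine[OF open_UNIV] UNIV_I])
  have f0: "?f ?z = 0" by (simp add: xz)
  have ginvS: "smooth_on S (\<lambda>z. ginv ?g z $ I $ J)" for I J
    unfolding ginv_def by (rule smooth_on_matrix_inv[OF S gS dS])
  have "smooth_on S (\<lambda>z. (z $ Top) powr w * \<beta> (xpart z))"
    by (rule smooth_on_mult[OF S smooth_on_powr[OF S smooth_on_coordinate pS]
          smooth_on_xpart_compose[OF S \<beta> NS]])
  then have "vanishing_form S ?z ?f (2 * k + 0) (\<beta> x) (\<lambda>z. (z $ Top) powr w * F (xpart z))"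
    by (rule vanishing_formI) (simp_all add: F NS xz, simp add: amb_pt_def)
  from vanishing_form_laplacian_power[OF S z f f0 ginvS smooth_on_chris[OF S gS dS] this]
  have "vanishing_form S ?z ?f 0 (fact (2 * k) *
      (\<Sum>a\<in>UNIV. \<Sum>b\<in>UNIV. ginv ?g ?z $ a $ b * pd a ?f ?z * pd b ?f ?z) ^ k * \<beta> x)
      ((laplacian ?g ^^ k) (\<lambda>z. (z $ Top) powr w * F (xpart z)))"
    by simp
  note at_point = vanishing_form_value[OF S z f f0 this]
  have "(\<Sum>a\<in>UNIV. \<Sum>b\<in>UNIV. ginv ?g ?z $ a $ b * pd a ?f ?z * pd b ?f ?z)
      = \<xi> \<bullet> (ginv G x *v \<xi>)"
    by (simp add: pd_affine_xpart ginv_z sum_UNIV_ext quadratic_form_sum)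
  then show ?thesis using at_point by (simp only: if_True simp_thms)
qed

text \<open>A test density which is \<open>\<beta> f\<^sup>2\<^sup>k\<close> in the chart is inserted both into the expression of \<open>P\<close> by
coefficients and into the ambient formula. The comparison determines the symbol formed from arbitrary coefficients of \<open>P\<close>.\<close>
lemma symb_gjms:
  fixes X :: "('m::t2_space, 'n::finite) cmfd"
  assumes A: "smooth_atlas (atlas X)" and c: "conformal_class (atlas X) (cclass X)"
    and P: "is_gjms X k P" and g: "g \<in> cclass X" and ch: "ch \<in> atlas X"
    and p: "p \<in> fst ch \<inter> body X"
    and a: "is_coeffs X (body X) (real k - real CARD('n) / 2) (2 * k) P g ch a"
  shows "symb a (2 * k) (snd ch p) \<xi> = (\<xi> \<bullet> (matrix_inv (g ch p) *v \<xi>)) ^ k"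
proof -
  let ?w = "real k - real CARD('n) / 2" and ?D = "snd ch ` fst ch" and ?x = "snd ch p"
  have p': "p \<in> fst ch" using p by blast
  have D: "open ?D" "?x \<in> ?D"
    using chart_properties(5)[OF A ch] p by auto
  let ?f = "\<lambda>y. \<xi> \<bullet> (y - ?x)"
  have f: "smooth_on ?D ?f" "?f ?x = 0" by (simp_all add: smooth_on_affine D(1))
  obtain V \<beta> where V: "V \<in> densities X ?w" "smooth_on ?D \<beta>" "\<beta> ?x > 0"
    "\<And>y. y \<in> ?D \<Longrightarrow> loc ch (V g) y = \<beta> y * ?f y ^ (2 * k)"
    by (rule test_density[OF A c g ch p' smooth_on_power[OF D(1) f(1)], of ?w "2 * k"]) (rule that)
  have form: "vanishing_form ?D ?x ?f (2 * k) (\<beta> ?x) (loc ch (V g))"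
    by (rule vanishing_formI[OF V(2)]) (simp_all add: V(4))
  have "P V g p = (\<Sum>l | length l \<le> 2 * k. a l ?x * pds l (loc ch (V g)) ?x)"
    using a V(1) p unfolding is_coeffs_def by blast
  also have "\<dots> = fact (2 * k) * \<beta> ?x * symb a (2 * k) ?x \<xi>"
    by (subst diff_op_at_vanishing_form[OF D f form]) (simp add: pd_affine)
  finally have lhs: "P V g p = fact (2 * k) * \<beta> ?x * symb a (2 * k) ?x \<xi>" .
  obtain N \<gamma> where N: "open N" "?x \<in> N" "N \<subseteq> ?D"
    and amb: "ambient_metric (conformally_flat X) (snd ch ` (fst ch \<inter> body X)) N (loc ch (g ch)) \<gamma>"
    and PV: "P V g p = (laplacian (amb_metric \<gamma>) ^^ k)
         (\<lambda>z. (z $ Top) powr ?w * loc ch (V g) (xpart z)) (amb_pt 1 ?x 0)"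
    using P V(1) g ch p unfolding is_gjms_def Let_def by blast
  have G: "loc ch (g ch) ?x = g ch p" using loc_chart[OF A ch] p by blast
  have "invertible (loc ch (g ch) ?x)"
    unfolding G using conformal_class_posdef[OF c g ch] p by (intro posdef_invertible) auto
  then have "P V g p = fact (2 * k) * (\<xi> \<bullet> (ginv (loc ch (g ch)) ?x *v \<xi>)) ^ k * \<beta> ?x"
    unfolding PV using N V(4)
    by (intro ambient_laplacian_power[OF amb N(1,2) _ smooth_on_subset[OF V(2)]]) auto
  then show ?thesis using lhs V(3) by (simp add: ginv_def G)
qed

section \<open>Symbols along a line of covectors\<close>

lemma poly_eqI_real:
  fixes p q :: "complex poly"
  assumes "\<And>t::real. poly p (of_real t) = poly q (of_real t)"
  shows "p = q"
proof (rule ccontr)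
  assume "p \<noteq> q"
  then have "finite {z. poly (p - q) z = 0}" by (intro poly_roots_finite) simp
  moreover have "range complex_of_real \<subseteq> {z. poly (p - q) z = 0}" using assms by auto
  ultimately have "finite (range complex_of_real)" by (rule finite_subset[rotated])
  then show False using finite_imageD[of complex_of_real UNIV] infinite_UNIV_char_0[where 'a = real]
    by (simp add: inj_on_def)
qed

lemma poly_symb_line:
  "poly (symb_line a m x \<eta> \<nu>) (of_real t) = of_real (symb a m x (\<eta> + t *\<^sub>R \<nu>))"
proof -
  have "poly (\<Prod>i\<leftarrow>l. [:complex_of_real (\<eta> $ i), of_real (\<nu> $ i):]) (of_real t)
      = of_real (\<Prod>i\<leftarrow>l. (\<eta> + t *\<^sub>R \<nu>) $ i)" for l
    by (induction l) (simp_all add: algebra_simps)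
  then show ?thesis by (simp add: symb_line_def symb_def poly_sum)
qed

lemma
  fixes \<eta> :: "real^'a::finite"
  shows degree_symb_line: "degree (symb_line a m x \<eta> \<nu>) \<le> m" (is ?thesis1)
  and coeff_symb_line: "coeff (symb_line a m x \<eta> \<nu>) m = of_real (symb a m x \<nu>)" (is ?thesis2)
proof -
  let ?p = "\<lambda>l. \<Prod>i\<leftarrow>l. [:complex_of_real (\<eta> $ i), of_real (\<nu> $ i):]"
  have *: "degree (?p l) \<le> length l \<and> coeff (?p l) (length l) = of_real (\<Prod>i\<leftarrow>l. \<nu> $ i)" for l
  proof (induction l)
    case (Cons i l)
    have "degree (?p (i # l)) \<le> degree [:complex_of_real (\<eta> $ i), of_real (\<nu> $ i):] + degree (?p l)"
      unfolding list.map prod_list.Cons by (rule degree_mult_le)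
    also have "\<dots> \<le> Suc (length l)" using Cons by simp
    finally have "degree (?p (i # l)) \<le> Suc (length l)" .
    moreover have "coeff (?p l) (Suc (length l)) = 0" using Cons by (intro coeff_eq_0) simp
    ultimately show ?case using Cons by (simp add: mult_pCons_left)
  qed simp
  show ?thesis1
    unfolding symb_line_def
  proof (rule degree_sum_le)
    show "finite {l :: 'a list. length l = m}"
      using finite_lists_length_eq[of "UNIV :: 'a set" m] by simp
    fix l :: "'a list" assume "l \<in> {l. length l = m}"
    then show "degree (smult (of_real (a l x)) (?p l)) \<le> m"
      using *[of l] degree_smult_le[of "of_real (a l x)" "?p l"] by simp
  qed
  have "coeff (?p l) m = of_real (\<Prod>i\<leftarrow>l. \<nu> $ i)" if "length l = m" for l
    using * that by blast
  then show ?thesis2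
    unfolding symb_line_def symb_def by (simp add: coeff_sum)
qed

lemma symb_scaleR: "symb a m x (c *\<^sub>R \<xi>) = c ^ m * symb a m x \<xi>"
proof -
  have "(\<Prod>i\<leftarrow>l. (c *\<^sub>R \<xi>) $ i) = c ^ length l * (\<Prod>i\<leftarrow>l. \<xi> $ i)" for l
    by (induction l) auto
  then show ?thesis by (simp add: symb_def sum_distrib_left mult_ac)
qed

text \<open>The coefficients of a combination that is divisible by \<open>q\<close>, and therefore zero, vanish one after
the other from the top, as the \<open>b i\<close> have pairwise different degrees less than that of \<open>q\<close>.\<close>
lemma independent_mod_degrees:
  assumes q: "degree q = k" and b: "\<And>i. i < k \<Longrightarrow> degree (b i) \<le> i" "\<And>i. i < k \<Longrightarrow> coeff (b i) i \<noteq> 0"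
  shows "independent_mod q k b"
  unfolding independent_mod_def
proof (intro allI impI, rule ccontr)
  fix c i assume dvd: "q dvd (\<Sum>i<k. smult (c i) (b i))" and i: "i < k" "c i \<noteq> 0"
  let ?S = "\<Sum>i<k. smult (c i) (b i)" and ?I = "{i. i < k \<and> c i \<noteq> 0}"
  have "degree ?S \<le> k - 1"
  proof (rule degree_sum_le)
    fix l assume "l \<in> {..<k}"
    then have "degree (b l) \<le> k - 1" using b(1)[of l] by simp
    then show "degree (smult (c l) (b l)) \<le> k - 1"
      using degree_smult_le[of "c l" "b l"] by linarith
  qed simp
  then have "?S = 0"
    using dvd_imp_degree_le[OF dvd] q i(1) by linarith
  have I: "finite ?I" "?I \<noteq> {}" using i by auto
  define j where "j = Max ?I"
  have j: "j \<in> ?I" and max: "\<And>l. l \<in> ?I \<Longrightarrow> l \<le> j"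
    unfolding j_def by (rule Max_in[OF I], rule Max_ge[OF I(1)])
  have "coeff (smult (c l) (b l)) j = 0" if "l < k" "l \<noteq> j" for l
  proof (cases "l < j")
    case True
    then show ?thesis using b(1)[OF that(1)] by (simp add: coeff_eq_0)
  next
    case False
    then show ?thesis using max[of l] that by auto
  qed
  then have "coeff ?S j = (\<Sum>l<k. if l = j then c j * coeff (b j) j else 0)"
    unfolding coeff_sum by (intro sum.cong) auto
  also have "\<dots> = c j * coeff (b j) j" using j by simp
  finally show False using \<open>?S = 0\<close> j b(2) by simp
qed

text \<open>On the line, the quadratic form is \<open>(\<tau> + B)\<^sup>2 + E\<close>, and \<open>E\<close> is its value at \<open>\<eta> - B\<nu>\<close>, which is
positive because \<open>\<eta>\<close> is no multiple of \<open>\<nu>\<close>.\<close>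
lemma labelled_zeros_quadratic_power:
  fixes M :: "real^'n::finite^'n"
  assumes pos: "\<And>\<xi>. \<xi> \<noteq> 0 \<Longrightarrow> \<xi> \<bullet> (M *v \<xi>) > 0" and \<nu>: "\<nu> \<bullet> (M *v \<nu>) = 1"
    and \<eta>: "\<nexists>s. \<eta> = s *\<^sub>R \<nu>" and a: "\<And>\<xi>. symb a (2 * k) x \<xi> = (\<xi> \<bullet> (M *v \<xi>)) ^ k"
  shows "\<exists>\<tau>p \<tau>m. labelled_zeros (symb_line a (2 * k) x \<eta> \<nu>) k \<tau>p \<tau>m"
proof -
  define B where "B = (\<eta> \<bullet> (M *v \<nu>) + \<nu> \<bullet> (M *v \<eta>)) / 2"
  define E where "E = \<eta> \<bullet> (M *v \<eta>) - B\<^sup>2"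
  have Q: "(\<eta> + t *\<^sub>R \<nu>) \<bullet> (M *v (\<eta> + t *\<^sub>R \<nu>)) = (t + B)\<^sup>2 + E" for t
    using \<nu> by (simp add: B_def E_def inner_add_left inner_add_right matrix_vector_right_distrib
        matrix_vector_mult_scaleR power2_eq_square field_simps)
  have "\<eta> + (- B) *\<^sub>R \<nu> \<noteq> 0"
    using \<eta> by (metis add_eq_0_iff2 minus_minus scaleR_minus_left)
  from pos[OF this] have E: "E > 0" unfolding Q by simp
  define z where "z = Complex (- B) (sqrt E)"
  define z' where "z' = Complex (- B) (- sqrt E)"
  have zz': "(of_real t - z) * (of_real t - z') = of_real ((t + B)\<^sup>2 + E)" for t
    using E by (simp add: complex_eq_iff z_def z'_def power2_eq_square algebra_simps)
  have "symb_line a (2 * k) x \<eta> \<nu> = (\<Prod>i<k. [:- z, 1:] * [:- z', 1:])"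
  proof (rule poly_eqI_real)
    fix t :: real
    have "poly (\<Prod>i<k. [:- z, 1:] * [:- z', 1:]) (of_real t) = ((of_real t - z) * (of_real t - z')) ^ k"
      by (simp add: poly_power algebra_simps)
    then show "poly (symb_line a (2 * k) x \<eta> \<nu>) (of_real t)
        = poly (\<Prod>i<k. [:- z, 1:] * [:- z', 1:]) (of_real t)"
      by (simp only: poly_symb_line a Q zz' of_real_power)
  qed
  then have "labelled_zeros (symb_line a (2 * k) x \<eta> \<nu>) k (\<lambda>_. z) (\<lambda>_. z')"
    unfolding labelled_zeros_def using E by (auto simp: z_def z'_def intro!: exI[of _ 1])
  then show ?thesis by blast
qed

section \<open>Symbols of the boundary operators\<close>

text \<open>If \<open>B\<close> has order \<open>m\<close>, then \<open>B(t\<^sup>m V)\<close> on the boundary is \<open>m!\<close> times \<open>V\<close> times the symbol of \<open>B\<close> at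
\<open>dt\<close>. Transverse order \<open>m\<close> makes it nonzero for some \<open>V\<close>.\<close>
lemma symb_transverse_nonzero:
  fixes X :: "('m::t2_space, 'n::finite) cmfd"
  assumes A: "smooth_atlas (atlas X)" and g: "g \<in> cclass X" and ch: "ch \<in> atlas X"
    and p: "p \<in> fst ch \<inter> bdry X" and t: "defining_function X p U t"
    and B: "has_transverse_order X w m B" "m > 0"
    and b: "is_coeffs X (bdry X) w m B g ch b"
  shows "symb b m (snd ch p) (\<chi> i. pd i (loc ch t) (snd ch p)) \<noteq> 0"
proof -
  let ?x = "snd ch p"
  obtain V W where VW: "V \<in> densities X w" "W \<in> densities X w"
    "power_times_near X p t m V W" "B W g p \<noteq> 0"
    using B t p g unfolding has_transverse_order_def by blast
  obtain U' where U': "open U'" "p \<in> U'" "\<forall>g\<in>cclass X. \<forall>q\<in>U'. W g q = t q ^ m * V g q"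
    using VW(3) unfolding power_times_near_def by blast
  have U: "open U" "p \<in> U" "msmooth_on (atlas X) U t" "t p = 0"
    using t p unfolding defining_function_def by auto
  define S where "S = snd ch ` (fst ch \<inter> (U \<inter> U'))"
  have S: "open S" "?x \<in> S"
    unfolding S_def using open_chart_image[OF A ch] U(1,2) U'(1,2) p by auto
  have "smooth_on (snd ch ` (fst ch \<inter> U)) (loc ch t)"
    using U(3) ch unfolding msmooth_on_def by blast
  then have tS: "smooth_on S (loc ch t)" by (rule smooth_on_subset) (auto simp: S_def)
  have "smooth_on (snd ch ` fst ch) (loc ch (V g))"
    using VW(1) g ch unfolding densities_def msmooth_on_def by auto
  then have VS: "smooth_on S (loc ch (V g))" by (rule smooth_on_subset) (auto simp: S_def)
  have tx: "loc ch t ?x = 0" using loc_chart[OF A ch, of p t] p U(4) by auto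
  have "vanishing_form S ?x (loc ch t) m (loc ch (V g) ?x) (loc ch (W g))"
    by (rule vanishing_formI[OF VS]) (use U'(3) g in \<open>auto simp: S_def loc_chart[OF A ch]\<close>)
  then have "(\<Sum>l | length l \<le> m. b l ?x * pds l (loc ch (W g)) ?x)
      = fact m * loc ch (V g) ?x * symb b m ?x (\<chi> i. pd i (loc ch t) ?x)"
    by (rule diff_op_at_vanishing_form[OF S tS tx])
  moreover have "B W g p = (\<Sum>l | length l \<le> m. b l ?x * pds l (loc ch (W g)) ?x)"
    using b VW(2) p unfolding is_coeffs_def by blast
  ultimately show ?thesis using VW(4) by auto
qed

text \<open>Transverse order \<open>0\<close> does not ask for a section on which the operator is nonzero, so the restriction
\<open>\<delta>\<^sup>T\<^sub>0\<close> is treated separately, with a density that does not vanish at the point.\<close>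
lemma symb_restriction_nonzero:
  fixes X :: "('m::t2_space, 'n::finite) cmfd"
  assumes A: "smooth_atlas (atlas X)" and c: "conformal_class (atlas X) (cclass X)"
    and g: "g \<in> cclass X" and ch: "ch \<in> atlas X" and p: "p \<in> fst ch \<inter> S"
    and B: "\<And>V. V \<in> densities X w \<Longrightarrow> B V g p = V g p"
    and b: "is_coeffs X S w 0 B g ch b"
  shows "symb b 0 (snd ch p) \<xi> \<noteq> 0"
proof -
  have p': "p \<in> fst ch" using p by blast
  obtain V \<beta> where V: "V \<in> densities X w" "smooth_on (snd ch ` fst ch) \<beta>" "\<beta> (snd ch p) > 0"
    "\<And>x. x \<in> snd ch ` fst ch \<Longrightarrow> loc ch (V g) x = \<beta> x * 1"
    by (rule test_density[OF A c g ch p' smooth_on_const, of w 1]) (rule that)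
  have "V g p = b [] (snd ch p) * loc ch (V g) (snd ch p)"
    using b p V(1) B[OF V(1)] unfolding is_coeffs_def by auto
  moreover have "V g p \<noteq> 0"
    using V(3) V(4)[of "snd ch p"] p loc_chart[OF A ch, of p "V g"] by auto
  ultimately show ?thesis by (auto simp: symb_def)
qed

lemma
  fixes X :: "('m::t2_space, 'n::finite) cmfd"
  assumes A: "smooth_atlas (atlas X)" and c: "conformal_class (atlas X) (cclass X)"
    and g: "g \<in> cclass X" and ch: "ch \<in> atlas X" and p: "p \<in> fst ch"
    and t: "defining_function X p U t"
  defines "\<nu> \<equiv> conormal_vec g ch t p"
  shows conormal_vec_unit: "\<nu> \<bullet> (matrix_inv (g ch p) *v \<nu>) = 1"
    and conormal_vec_multiple: "\<exists>s>0. \<nu> = s *\<^sub>R (\<chi> i. pd i (loc ch t) (snd ch p))"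
proof -
  let ?d = "\<chi> i. pd i (loc ch t) (snd ch p)" and ?M = "matrix_inv (g ch p)"
  have "\<exists>i. pd i (loc ch t) (snd ch p) \<noteq> 0"
    using t p ch unfolding defining_function_def by blast
  then have "?d \<noteq> 0" by (simp add: vec_eq_iff)
  then have pos: "?d \<bullet> (?M *v ?d) > 0"
    using conformal_class_posdef[OF c g ch p] by (intro posdef_matrix_inv)
  have \<nu>: "\<nu> = (1 / sqrt (?d \<bullet> (?M *v ?d))) *\<^sub>R ?d"
    unfolding \<nu>_def conormal_vec_def conormal_def quadratic_form_sum
    by (simp add: ginv_def loc_chart[OF A ch p] vec_eq_iff)
  show "\<nu> \<bullet> (?M *v \<nu>) = 1"
    using pos unfolding \<nu> by (simp add: matrix_vector_mult_scaleR)
  show "\<exists>s>0. \<nu> = s *\<^sub>R ?d" using pos \<nu> by (intro exI[of _ "1 / sqrt (?d \<bullet> (?M *v ?d))"]) auto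
qed

lemma has_order_restriction:
  assumes "\<forall>V\<in>densities X w. \<forall>g\<in>cclass X. \<forall>p\<in>bdry X. B V g p = V g p"
    and A: "smooth_atlas (atlas X)"
  shows "has_order X (bdry X) w 0 B"
proof -
  have "is_coeffs X (bdry X) w 0 B g ch (\<lambda>_ _. 1)" if "g \<in> cclass X" "ch \<in> atlas X" for g ch
    using assms(1) that unfolding is_coeffs_def by (auto simp: loc_chart[OF A])
  then show ?thesis unfolding has_order_def diff_op_def by blast
qed

section \<open>The boundary problem\<close>

theorem lemma6p5:
  fixes X :: "('m::{t2_space,second_countable_topology}, 'n::finite) cmfd"
    and P :: "nat \<Rightarrow> ('m,'n) dop"
    and \<Psi> :: "nat \<Rightarrow> tpoly"
    and \<delta>T :: "nat \<Rightarrow> ('m,'n) dop"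
    and k :: nat
  assumes "CARD('n) \<ge> 3"
    and "compact_conformal_manifold_with_boundary X"
    and "k > 0"
    and "gjms_range X k"
    and "\<And>k'. k' \<ge> 1 \<Longrightarrow> gjms_range X k' \<Longrightarrow> is_gjms X k' (P k')"
    and "\<And>k'. k' \<ge> 1 \<Longrightarrow> gjms_range X k' \<Longrightarrow> gover_peterson X k' (P k') (\<Psi> k')"
    and "\<And>i. i < k \<Longrightarrow> is_deltaT X \<Psi> (real k - real CARD('n) / 2) i (\<delta>T i)"
  shows "lopatinski_shapiro X (real k - real CARD('n) / 2) k (P k) \<delta>T"
proof -
  let ?w = "real k - real CARD('n) / 2"
  have A: "smooth_atlas (atlas X)" and c: "conformal_class (atlas X) (cclass X)"
    and closed: "bdry X \<subseteq> body X"
    using assms(2) compact_imp_closed[of "body X"] frontier_subset_closed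
    unfolding compact_conformal_manifold_with_boundary_def by blast+
  have P: "is_gjms X k (P k)" using assms(3-5) by simp
  note pos = conformal_class_posdef[OF c]
  have symb_P: "symb a (2 * k) (snd ch p) \<xi> = (\<xi> \<bullet> (matrix_inv (g ch p) *v \<xi>)) ^ k"
    if "g \<in> cclass X" "ch \<in> atlas X" "p \<in> fst ch \<inter> body X"
      "is_coeffs X (body X) ?w (2 * k) (P k) g ch a" for g ch p a \<xi>
    using symb_gjms[OF A c P] that by blast
  have "elliptic X ?w k (P k)"
    unfolding elliptic_def
  proof (intro ballI exI[of _ 1] conjI allI impI)
    fix g ch a p \<xi>
    assume *: "g \<in> cclass X" "ch \<in> atlas X" "is_coeffs X (body X) ?w (2 * k) (P k) g ch a"
      "p \<in> fst ch \<inter> body X"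
    have "\<xi> \<bullet> (matrix_inv (g ch p) *v \<xi>) \<ge> 0"
      using posdef_matrix_inv[OF pos[OF *(1,2)], of p \<xi>] *(4) by (cases "\<xi> = 0") auto
    then show "1 * sqrt (\<xi> \<bullet> (matrix_inv (g ch p) *v \<xi>)) ^ (2 * k) \<le> \<bar>symb a (2 * k) (snd ch p) \<xi>\<bar>"
      using symb_P[OF *(1,2,4,3)] by (simp add: power_mult)
  qed simp
  moreover have "properly_elliptic X ?w k (P k)"
    unfolding properly_elliptic_def
  proof (intro ballI allI impI)
    fix g ch a p U t \<eta>
    assume *: "g \<in> cclass X" "ch \<in> atlas X" "is_coeffs X (body X) ?w (2 * k) (P k) g ch a"
      "p \<in> fst ch \<inter> bdry X" "defining_function X p U t" "\<nexists>s. \<eta> = s *\<^sub>R conormal_vec g ch t p"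
    then have p: "p \<in> fst ch" "p \<in> fst ch \<inter> body X" using closed by auto
    show "\<exists>\<tau>p \<tau>m. labelled_zeros
        (symb_line a (2 * k) (snd ch p) \<eta> (conormal_vec g ch t p)) k \<tau>p \<tau>m"
      by (rule labelled_zeros_quadratic_power[OF _ conormal_vec_unit[OF A c *(1,2) p(1) *(5)] *(6)
            symb_P[OF *(1,2) p(2) *(3)]])
        (rule posdef_matrix_inv[OF pos[OF *(1,2) p(1)]])
  qed
  moreover have "\<exists>m. (\<forall>i<k. has_order X (bdry X) ?w (m i) (\<delta>T i) \<and> m i < 2 * k)
        \<and> (\<forall>i j. i < j \<longrightarrow> j < k \<longrightarrow> m i < m j)
        \<and> (\<forall>g\<in>cclass X. \<forall>ch\<in>atlas X. \<forall>a b.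
             is_coeffs X (body X) ?w (2*k) (P k) g ch a \<longrightarrow>
             (\<forall>i<k. is_coeffs X (bdry X) ?w (m i) (\<delta>T i) g ch (b i)) \<longrightarrow>
             (\<forall>p\<in>fst ch \<inter> bdry X. \<forall>U t. defining_function X p U t \<longrightarrow>
               (\<forall>\<eta>. (\<nexists>s. \<eta> = s *\<^sub>R conormal_vec g ch t p) \<longrightarrow>
                 (\<forall>\<tau>p \<tau>m. labelled_zeros
                     (symb_line a (2*k) (snd ch p) \<eta> (conormal_vec g ch t p)) k \<tau>p \<tau>m \<longrightarrow>
                   independent_mod (\<Prod>i<k. [:- \<tau>p i, 1:]) k
                     (\<lambda>i. symb_line (b i) (m i) (snd ch p) \<eta> (conormal_vec g ch t p))))))"
  proof (intro exI[of _ "\<lambda>i. i"] conjI allI impI ballI)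
    fix i assume i: "i < k"
    show "has_order X (bdry X) ?w i (\<delta>T i)"
      using assms(7)[OF i] has_order_restriction[OF _ A] unfolding is_deltaT_def
      by (auto split: if_splits)
    show "i < 2 * k" using i by simp
  next
    fix g ch a b p U t \<eta> \<tau>p \<tau>m
    assume g: "g \<in> cclass X" and ch: "ch \<in> atlas X"
      and b: "\<forall>i<k. is_coeffs X (bdry X) ?w i (\<delta>T i) g ch (b i)"
      and p: "p \<in> fst ch \<inter> bdry X" and t: "defining_function X p U t"
    let ?\<nu> = "conormal_vec g ch t p"
    have "symb (b i) i (snd ch p) ?\<nu> \<noteq> 0" if i: "i < k" for i
    proof (cases "i = 0")
      case True
      then show ?thesis
        using symb_restriction_nonzero[OF A c g ch p, of ?w "\<delta>T 0" "b 0"] assms(7)[OF i] b i g p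
        unfolding is_deltaT_def by auto
    next
      case False
      then have "has_transverse_order X ?w i (\<delta>T i)"
        using assms(7)[OF i] unfolding is_deltaT_def by auto
      then have "symb (b i) i (snd ch p) (\<chi> j. pd j (loc ch t) (snd ch p)) \<noteq> 0"
        using symb_transverse_nonzero[OF A g ch p t _ _ b[rule_format, OF i]] False by blast
      then show ?thesis
        using conormal_vec_multiple[OF A c g ch _ t] p by (auto simp: symb_scaleR)
    qed
    then show "independent_mod (\<Prod>i<k. [:- \<tau>p i, 1:]) k (\<lambda>i. symb_line (b i) i (snd ch p) \<eta> ?\<nu>)"
      by (intro independent_mod_degrees)
        (auto simp: degree_symb_line coeff_symb_line degree_prod_eq_sum_degree)
  qed
  moreover have "diff_op X (body X) ?w (2 * k) (P k)"
    using P unfolding is_gjms_def Let_def by blast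
  ultimately show ?thesis unfolding lopatinski_shapiro_def by blast
qed

end
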